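(* Let $b=\lambda+i\eta$ with $\eta\in\mathbb{R}$, and assume that either $k=0$ and $\lambda>1/2$, or $k\ge1$ is an integer and $\lambda>0$. Let $\nu^{(b;k)}$ be the probability measure on the unit circle whose Verblunsky coefficients are $$\beta_{n-1}^{(b;k)}=\frac{1}{\tau_{n-1}^{(b;k)}}\,\frac{1-2M_n^{(\lambda;k)}-i\,c_{k+n}^{(b)}}{1-i\,c_{k+n}^{(b)}},\qquad n\ge1,$$ where $\tau_0^{(b;k)}=1$ and $\tau_n^{(b;k)}=\tau_{n-1}^{(b;k)}\,(1-i\,c_{k+n}^{(b)})/(1+i\,c_{k+n}^{(b)})$ for $n\ge1$. If $d\varphi^{(b;k)}(x)=d\nu^{(b;k)}\big((x+i)/(x-i)\big)$, $x\in\mathbb{R}$, then for every $n\ge0$ $$\int_{-\infty}^{\infty}x^{j}\,\frac{\mathcal{P}_n^{(k)}(b;x)}{(x^2+1)^n}\,d\varphi^{(b;k)}(x)=\gamma_n^{(b;k)}\,\delta_{n,j},\qquad j=0,1,\ldots,n,$$ where $\gamma_0^{(b;k)}=1$ and $\gamma_n^{(b;k)}=(1-M_n^{(\lambda;k)})\,\gamma_{n-1}^{(b;k)}$ for $n\ge1$. Moreover, for every $n\ge1$, $$\mathcal{P}_{n-1}^{(k+1)}(b;x)=\int_{-\infty}^{\infty}\frac{(1+x^2)^n\,\mathcal{P}_n^{(k)}(b;t)-(1+t^2)^n\,\mathcal{P}_n^{(k)}(b;x)}{M_1^{(\lambda;k)}\,(t-x)\,(1+t^2)^n}\,d\varphi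^{(b;k)}(t).$$
   Context: For $b=\lambda+i\eta$ with $\lambda>0$, $\eta\in\mathbb{R}$, put $c_n^{(b)}=\frac{\eta}{\lambda+n-1}$ and $d_{n+1}^{(\lambda)}=\frac14\frac{n(n+2\lambda-1)}{(n+\lambda-1)(n+\lambda)}$ for $n\ge1$. For an integer $k\ge0$ the $k$-th associated complementary Romanovski-Routh (CRR) polynomials are defined by $\mathcal{P}_0^{(k)}(b;x)=1$, $\mathcal{P}_1^{(k)}(b;x)=x-c_{k+1}^{(b)}$, and $\mathcal{P}_{n+1}^{(k)}(b;x)=(x-c_{k+n+1}^{(b)})\mathcal{P}_n^{(k)}(b;x)-d_{k+n+1}^{(\lambda)}(x^2+1)\mathcal{P}_{n-1}^{(k)}(b;x)$, $n\ge1$ (for $k=0$ these are the CRR polynomials). The sequence $\{M_n^{(\lambda;k)}\}_{n\ge1}$ is the maximal parameter sequence of the positive chain sequence $\{d_{k+n}^{(\lambda)}\}_{n\ge2}$, so that $d_{k+n+1}^{(\lambda)}=(1-M_n^{(\lambda;k)})M_{n+1}^{(\lambda;k)}$ for $n\ge1$. Explicitly: if $\lambda>1/2$ and $k\ge0$, then $M_n^{(\lambda;k)}=\frac12\frac{2\lambda+k+n-2}{\lambda+k+n-1}$, $n\ge1$; if $0<\lambda\le1/2$ and $k\ge1$, then $M_n^{(\lambda;k)}=\frac12\frac{k+n-1}{\lambda+k+n-1}$, $n\ge1$. The Verblunsky coefficients of a probability measure with infinite support on the unit circle are $\beta_{n-1}=-\overline{\Phi_n(0)}$, $n\ge1$,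 where $\Phi_n$ is the monic orthogonal polynomial of degree $n$ with respect to the measure; by Verblunsky's theorem every sequence in the open unit disc is the sequence of Verblunsky coefficients of exactly one such measure. The measure $\varphi^{(b;k)}$ on $\mathbb{R}$ is the transport of $\nu^{(b;k)}$ under the correspondence $\zeta=(x+i)/(x-i)$ between $x\in\mathbb{R}$ and $\zeta$ in the unit circle minus $\{1\}$. *)

theory Defs
  imports "HOL-Probability.Probability" "HOL-Computational_Algebra.Polynomial"
begin

subsection \<open>Associated complementary Romanovski-Routh polynomials\<close>

text \<open>The indices of \<open>c\<close> and \<open>d\<close> are those of the recurrence: \<open>c\<close> is used from index 1 and
  \<open>d\<close> from index 2 on, where \<open>d\<close> at \<open>n + 1\<close> is
  \<open>1/4 * n (n + 2 lam - 1) / ((n + lam - 1) (n + lam))\<close>.\<close>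

definition crr_c :: "complex \<Rightarrow> nat \<Rightarrow> real" where
  "crr_c b n = Im b / (Re b + real n - 1)"

definition crr_d :: "real \<Rightarrow> nat \<Rightarrow> real" where
  "crr_d lam m = (let n = real m - 1 in
     1/4 * (n * (n + 2 * lam - 1)) / ((n + lam - 1) * (n + lam)))"

fun crr_poly :: "complex \<Rightarrow> nat \<Rightarrow> nat \<Rightarrow> real poly" where
  "crr_poly b k 0 = 1"
| "crr_poly b k (Suc 0) = [:- crr_c b (k + 1), 1:]"
| "crr_poly b k (Suc (Suc n)) =
     [:- crr_c b (k + n + 2), 1:] * crr_poly b k (Suc n)
     - smult (crr_d (Re b) (k + n + 2)) ([:1, 0, 1:] * crr_poly b k n)"


subsection \<open>Chain sequences and maximal parameter sequences\<close>

text \<open>Parameters \<open>g\<close> of a positive chain sequence \<open>a\<close> are indexed from 0, the chain sequence from 1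
  (the value \<open>a 0\<close> plays no role).\<close>

definition parameter_sequence :: "(nat \<Rightarrow> real) \<Rightarrow> (nat \<Rightarrow> real) \<Rightarrow> bool" where
  "parameter_sequence a g \<longleftrightarrow>
     0 \<le> g 0 \<and> g 0 < 1 \<and> (\<forall>n. 0 < g (Suc n) \<and> g (Suc n) < 1) \<and>
     (\<forall>n. a (Suc n) = (1 - g n) * g (Suc n))"

definition is_maximal_parameter_sequence :: "(nat \<Rightarrow> real) \<Rightarrow> (nat \<Rightarrow> real) \<Rightarrow> bool" where
  "is_maximal_parameter_sequence a g \<longleftrightarrow>
     parameter_sequence a g \<and> (\<forall>h. parameter_sequence a h \<longrightarrow> (\<forall>n. h n \<le> g n))"

definition maximal_parameter_sequence :: "(nat \<Rightarrow> real) \<Rightarrow> nat \<Rightarrow> real" where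
  "maximal_parameter_sequence a = (THE g. is_maximal_parameter_sequence a g)"

text \<open>The sequence below is indexed from 1, which is why the index is shifted by one against the
  general notion. Its closed form is \<open>crr_M_explicit\<close>.\<close>

definition crr_M :: "real \<Rightarrow> nat \<Rightarrow> nat \<Rightarrow> real" where
  "crr_M lam k n = maximal_parameter_sequence (\<lambda>m. crr_d lam (k + m + 1)) (n - 1)"

lemma maximal_parameter_sequence_eqI:
  assumes "is_maximal_parameter_sequence a g"
  shows "maximal_parameter_sequence a = g"
  unfolding maximal_parameter_sequence_def
proof (rule the_equality)
  show "is_maximal_parameter_sequence a g" by (rule assms)
next
  fix h assume "is_maximal_parameter_sequence a h"
  with assms show "h = g"
    unfolding is_maximal_parameter_sequence_def by (intro ext antisym) auto
qed

text \<open>A sufficient condition for maximality: the quotients \<open>M n / (1 - M n)\<close> are so large that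
  their partial products have a divergent sum.\<close>

lemma maximal_parameter_sequenceI:
  assumes M: "parameter_sequence a M"
    and ge: "\<And>n. real (k + Suc n) / real (k + n + 2) \<le> M (Suc n) / (1 - M (Suc n))"
  shows "is_maximal_parameter_sequence a M"
  unfolding is_maximal_parameter_sequence_def
proof (intro conjI M allI impI)
  fix g m assume g: "parameter_sequence a g"
  show "g m \<le> M m"
  proof (rule ccontr)
    assume "\<not> g m \<le> M m"
    hence em: "g m - M m > 0" by simp
    have Mp: "0 < M (Suc n)" "M (Suc n) < 1" for n
      using M by (auto simp: parameter_sequence_def)
    have M1: "M n < 1" for n using M by (cases n) (auto simp: parameter_sequence_def)
    have g1: "g n < 1" for n using g by (cases n) (auto simp: parameter_sequence_def)
    have step: "(1 - g n) * (g (Suc n) - M (Suc n)) = (g n - M n) * M (Suc n)" for n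
    proof -
      have "(1 - g n) * g (Suc n) = (1 - M n) * M (Suc n)"
        using M g unfolding parameter_sequence_def by metis
      thus ?thesis by (simp add: algebra_simps)
    qed
    have pos: "g (m + n) - M (m + n) > 0" for n
    proof (induction n)
      case (Suc n)
      have "(1 - g (m + n)) * (g (Suc (m + n)) - M (Suc (m + n))) > 0"
        unfolding step using Suc Mp by simp
      thus ?case using g1[of "m + n"] by (simp add: zero_less_mult_iff)
    qed (use em in simp)
    define y where "y n = M (m + Suc n) / (g (m + Suc n) - M (m + Suc n)) / real (k + m + n + 1)" for n
    have ypos: "y n > 0" for n
      using pos[of "Suc n"] Mp[of "m + n"] unfolding y_def by simp
    have dec: "y (Suc n) \<le> y n - 1 / real (k + m + n + 2)" for n
    proof -
      define N where "N = m + n"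
      define e where "e = g (Suc N) - M (Suc N)"
      define e' where "e' = g (Suc (Suc N)) - M (Suc (Suc N))"
      define p where "p = M (Suc N)"
      define q where "q = M (Suc (Suc N))"
      have e: "e > 0" "e' > 0" using pos[of "Suc n"] pos[of "Suc (Suc n)"]
        by (simp_all add: e_def e'_def N_def)
      have pq: "0 < p" "p < 1" "0 < q" using Mp by (auto simp: p_def q_def)
      have "(1 - p - e) * e' = e * q"
        using step[of "Suc N"] by (simp add: p_def q_def e_def e'_def)
      hence "q / e' = (1 - p) / e - 1" using e by (simp add: field_simps)
      moreover have "(1 - p) / e \<le> p / e * (real (k + N + 2) / real (k + Suc N))"
      proof -
        have "real (k + Suc N) / real (k + N + 2) \<le> p / (1 - p)"
          using ge[of N] by (simp add: p_def)
        hence "real (k + Suc N) * (1 - p) \<le> p * real (k + N + 2)"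
          using pq by (subst (asm) frac_le_eq) (auto simp: field_simps divide_le_0_iff)
        hence "1 - p \<le> p * real (k + N + 2) / real (k + Suc N)"
          by (subst pos_le_divide_eq) (simp_all add: mult.commute)
        hence "(1 - p) / e \<le> p * real (k + N + 2) / real (k + Suc N) / e"
          using e by (intro divide_right_mono) auto
        thus ?thesis by (simp add: mult.commute)
      qed
      ultimately have "q / e' \<le> p / e * (real (k + N + 2) / real (k + Suc N)) - 1" by simp
      hence "q / e' / real (k + N + 2) \<le>
             (p / e * (real (k + N + 2) / real (k + Suc N)) - 1) / real (k + N + 2)"
        by (rule divide_right_mono) simp
      also have "\<dots> = p / e / real (k + Suc N) - 1 / real (k + N + 2)"
      proof -
        have "real (k + N + 2) > 0" "real (k + Suc N) > 0" by simp_all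
        hence ne: "real (k + N + 2) \<noteq> 0" "real (k + Suc N) \<noteq> 0" by linarith+
        have "(u * (v / w) - 1) / v = u / w - 1 / v" if "v \<noteq> 0" "w \<noteq> 0" for u v w :: real
          using that by (simp add: field_simps)
        from this[OF ne] show ?thesis .
      qed
      finally show ?thesis
        by (simp add: y_def N_def p_def q_def e_def e'_def add_ac)
    qed
    have bound: "y n \<le> y 0 - (\<Sum>i<n. 1 / real (i + (k + m + 2)))" for n
    proof (induction n)
      case (Suc n)
      thus ?case using dec[of n] by (simp add: add_ac)
    qed simp
    have "summable (\<lambda>i. 1 / real (i + (k + m + 2)))"
    proof (rule summableI_nonneg_bounded)
      show "(\<Sum>i<n. 1 / real (i + (k + m + 2))) \<le> y 0" for n
        using bound[of n] ypos[of n] by linarith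
    qed simp
    hence "summable (\<lambda>i. 1 / real i)"
      using summable_iff_shift[of "\<lambda>i. 1 / real i" "k + m + 2"] by simp
    thus False
      using not_summable_harmonic[where 'a = real] by (simp add: inverse_eq_divide)
  qed
qed

lemma crr_M_explicit:
  assumes "lam > 0" "k = 0 \<and> lam > 1/2 \<or> k \<ge> 1" "n \<ge> 1"
  shows "crr_M lam k n =
    (if lam > 1/2 then 1/2 * (2 * lam + real k + real n - 2) / (lam + real k + real n - 1)
     else 1/2 * (real k + real n - 1) / (lam + real k + real n - 1))"
proof -
  define M where "M n =
    (if lam > 1/2 then 1/2 * (2 * lam + real k + real n - 1) / (lam + real k + real n)
     else 1/2 * (real k + real n) / (lam + real k + real n))" for n :: nat
  have posd: "lam + real k + real n > 0" for n :: nat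
    using assms(1) by linarith
  have rng: "0 < M n \<and> M n < 1" for n
    using posd[of n] assms by (auto simp: M_def field_simps)
  have comp: "1 - M n =
    (if lam > 1/2 then 1/2 * (real k + real n + 1) / (lam + real k + real n)
     else 1/2 * (2 * lam + real k + real n) / (lam + real k + real n))" for n
  proof -
    have "1 - 1/2 * u / v = 1/2 * (2 * v - u) / v" if "v > 0" for u v :: real
      using that by (simp add: field_simps)
    note h = this[OF posd[of n]]
    have "2 * (lam + real k + real n) - (2 * lam + real k + real n - 1) = real k + real n + 1"
      "2 * (lam + real k + real n) - (real k + real n) = 2 * lam + real k + real n"
      by simp_all
    thus ?thesis
      unfolding M_def using h[of "2 * lam + real k + real n - 1"] h[of "real k + real n"]
      by (simp only: split: if_split) blast
  qed
  have "parameter_sequence (\<lambda>m. crr_d lam (k + m + 1)) M"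
    unfolding parameter_sequence_def
  proof (intro conjI allI)
    show "crr_d lam (k + Suc n + 1) = (1 - M n) * M (Suc n)" for n
    proof -
      define t where "t = real k + real n"
      have t: "lam + t > 0" "lam + t + 1 > 0" using posd[of n] by (simp_all add: t_def)
      have n: "real (k + Suc n + 1) - 1 = t + 1" by (simp add: t_def)
      have "t + 1 + 2 * lam - 1 = t + 2 * lam" "t + 1 + lam - 1 = lam + t" "t + 1 + lam = lam + t + 1"
        by simp_all
      hence "crr_d lam (k + Suc n + 1) =
          1/4 * ((t + 1) * (t + 2 * lam)) / ((lam + t) * (lam + t + 1))"
        unfolding crr_d_def Let_def n by (simp only:)
      moreover have "(1 - M n) * M (Suc n) =
          1/4 * ((t + 1) * (t + 2 * lam)) / ((lam + t) * (lam + t + 1))"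
      proof -
        have half: "(1/2 * u / v) * (1/2 * u' / v') = 1/4 * (u * u') / (v * v')" for u u' v v' :: real
          by simp
        have lt: "lam + real k + real n = lam + t" "lam + real k + real (Suc n) = lam + t + 1"
          "real k + real n + 1 = t + 1" "2 * lam + real k + real n = t + 2 * lam"
          "2 * lam + real k + real (Suc n) - 1 = t + 2 * lam" "real k + real (Suc n) = t + 1"
          by (simp_all add: t_def)
        show ?thesis
          unfolding comp unfolding M_def lt
          by (cases "lam > 1/2") (simp_all only: if_True if_False half mult.commute[of "t + 2 * lam"])
      qed
      ultimately show ?thesis by simp
    qed
  qed (use rng[of 0] rng[of "Suc n" for n] in auto)
  moreover have "real (k + Suc n) / real (k + n + 2) \<le> M (Suc n) / (1 - M (Suc n))" for n
  proof -
    define t where "t = real k + real n"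
    have t: "t \<ge> 0" by (simp add: t_def)
    have d: "lam + t + 1 > 0" using posd[of "Suc n"] by (simp add: t_def)
    have quot: "(1/2 * u / v) / (1/2 * w / v) = u / w" if "v > 0" for u v w :: real
      using that by simp
    have lt: "lam + real k + real (Suc n) = lam + t + 1"
      "2 * lam + real k + real (Suc n) - 1 = 2 * lam + t" "real k + real (Suc n) = t + 1"
      "real k + real (Suc n) + 1 = t + 2" "2 * lam + real k + real (Suc n) = 2 * lam + t + 1"
      by (simp_all add: t_def)
    show ?thesis
    proof (cases "lam > 1/2")
      case True
      have "M (Suc n) / (1 - M (Suc n)) = (2 * lam + t) / (t + 2)"
        unfolding comp unfolding M_def lt using True by (simp only: if_True quot[OF d]) simp
      moreover have "(t + 1) / (t + 2) \<le> (2 * lam + t) / (t + 2)"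
        using True t by (intro divide_right_mono) auto
      ultimately show ?thesis by (simp add: t_def add_ac)
    next
      case False
      have "M (Suc n) / (1 - M (Suc n)) = (t + 1) / (2 * lam + t + 1)"
        unfolding comp unfolding M_def lt using False by (simp only: if_False quot[OF d])
      moreover have "(t + 1) / (t + 2) \<le> (t + 1) / (2 * lam + t + 1)"
        using False t assms(1) by (intro divide_left_mono) auto
      ultimately show ?thesis by (simp add: t_def add_ac)
    qed
  qed
  ultimately have "maximal_parameter_sequence (\<lambda>m. crr_d lam (k + m + 1)) = M"
    by (intro maximal_parameter_sequence_eqI maximal_parameter_sequenceI)
  thus ?thesis
    using assms(3) by (simp add: crr_M_def M_def of_nat_diff algebra_simps)
qed


subsection \<open>Verblunsky coefficients of measures on the unit circle\<close>

text \<open>A measure on the unit circle is a Borel measure on the complex plane that is concentrated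
  on the circle.\<close>

definition measure_support :: "'a::topological_space measure \<Rightarrow> 'a set" where
  "measure_support M = {x. \<forall>U. open U \<and> x \<in> U \<longrightarrow> emeasure M U > 0}"

definition circle_prob_measure :: "complex measure \<Rightarrow> bool" where
  "circle_prob_measure nu \<longleftrightarrow>
     prob_space nu \<and> sets nu = sets borel \<and> (AE z in nu. z \<in> sphere 0 1) \<and>
     infinite (measure_support nu)"

definition monic_OP :: "complex measure \<Rightarrow> nat \<Rightarrow> complex poly" where
  "monic_OP nu n = (THE p. degree p = n \<and> lead_coeff p = 1 \<and>
     (\<forall>j<n. (\<integral>z. poly p z * cnj (z ^ j) \<partial>nu) = 0))"

definition verblunsky :: "complex measure \<Rightarrow> nat \<Rightarrow> complex" where
  "verblunsky nu n = - cnj (poly (monic_OP nu (Suc n)) 0)"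


subsection \<open>Transport to the real line\<close>

definition line_to_circle :: "real \<Rightarrow> complex" where
  "line_to_circle x = (complex_of_real x + \<i>) / (complex_of_real x - \<i>)"

text \<open>The inverse of \<open>x \<mapsto> (x + i) / (x - i)\<close> is \<open>z \<mapsto> i (z + 1) / (z - 1)\<close>. A point mass at 1 is
  dropped. See \<open>emeasure_line_measure\<close> for the characteristic property.\<close>

definition circle_to_line :: "complex \<Rightarrow> real" where
  "circle_to_line z = Re (\<i> * (z + 1) / (z - 1))"

definition line_measure :: "complex measure \<Rightarrow> real measure" where
  "line_measure nu = distr (restrict_space nu (sphere 0 1 - {1})) borel circle_to_line"

lemma circle_to_line_to_circle:
  "line_to_circle x \<in> sphere 0 1 - {1}" "circle_to_line (line_to_circle x) = x"
proof -
  have ne: "complex_of_real x - \<i> \<noteq> 0" by (simp add: complex_eq_iff)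
  have "cmod (complex_of_real x + \<i>) = cmod (complex_of_real x - \<i>)"
    by (simp add: cmod_def)
  hence "cmod (line_to_circle x) = 1"
    using ne by (simp add: line_to_circle_def norm_divide)
  moreover have "line_to_circle x - 1 = 2 * \<i> / (complex_of_real x - \<i>)"
    using ne by (simp add: line_to_circle_def field_simps)
  moreover have "line_to_circle x + 1 = 2 * complex_of_real x / (complex_of_real x - \<i>)"
    using ne by (simp add: line_to_circle_def field_simps)
  ultimately show "line_to_circle x \<in> sphere 0 1 - {1}" "circle_to_line (line_to_circle x) = x"
    using ne by (auto simp: circle_to_line_def)
qed

lemma line_to_circle_to_line:
  assumes "z \<in> sphere 0 1 - {1}"
  shows "line_to_circle (circle_to_line z) = z"
proof -
  have z: "z \<noteq> 1" "z * cnj z = 1"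
    using assms by (auto simp: complex_norm_square[symmetric])
  define w where "w = \<i> * (z + 1) / (z - 1)"
  have "z \<noteq> 0" using z by auto
  hence c: "cnj z = 1 / z" using z by (simp add: field_simps)
  have "cnj w = w"
    using z \<open>z \<noteq> 0\<close> unfolding w_def by (simp add: c divide_simps) (simp add: algebra_simps)
  hence "complex_of_real (Re w) = w"
    by (simp add: complex_eq_iff)
  hence "line_to_circle (circle_to_line z) = (w + \<i>) / (w - \<i>)"
    by (simp add: line_to_circle_def circle_to_line_def w_def)
  also have "w + \<i> = 2 * \<i> * z / (z - 1)" using z by (simp add: w_def field_simps)
  also have "w - \<i> = 2 * \<i> / (z - 1)" using z by (simp add: w_def field_simps)
  finally show ?thesis using z by simp
qed

lemma emeasure_line_measure:
  assumes nu: "sets nu = sets borel" and A: "A \<in> sets borel"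
  shows "emeasure (line_measure nu) A = emeasure nu (line_to_circle ` A)"
proof -
  let ?S = "sphere 0 1 - {1} :: complex set"
  have sp: "space nu = UNIV" using sets_eq_imp_space_eq[OF nu] by simp
  have S: "?S \<in> sets borel" by auto
  have "circle_to_line \<in> borel_measurable borel"
    unfolding circle_to_line_def by measurable
  hence "circle_to_line \<in> borel_measurable nu"
    by (simp add: measurable_cong_sets[OF nu refl])
  hence meas: "circle_to_line \<in> borel_measurable (restrict_space nu ?S)"
    by (rule measurable_restrict_space1)
  have "line_to_circle ` A = circle_to_line -` A \<inter> ?S"
  proof (intro equalityI subsetI)
    fix z assume "z \<in> circle_to_line -` A \<inter> ?S"
    thus "z \<in> line_to_circle ` A"
      using line_to_circle_to_line[of z] by (intro image_eqI[of _ _ "circle_to_line z"]) auto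
  next
    fix z assume "z \<in> line_to_circle ` A"
    then obtain x where "z = line_to_circle x" "x \<in> A" by blast
    thus "z \<in> circle_to_line -` A \<inter> ?S" using circle_to_line_to_circle[of x] by auto
  qed
  moreover have "emeasure (line_measure nu) A =
      emeasure (restrict_space nu ?S) (circle_to_line -` A \<inter> ?S)"
    unfolding line_measure_def using meas A
    by (subst emeasure_distr) (auto simp: space_restrict_space sp)
  ultimately show ?thesis
    using S by (simp add: emeasure_restrict_space sp nu)
qed


subsection \<open>Verblunsky coefficients, norms and second-kind integrand for the CRR polynomials\<close>

primrec crr_tau :: "complex \<Rightarrow> nat \<Rightarrow> nat \<Rightarrow> complex" where
  "crr_tau b k 0 = 1"
| "crr_tau b k (Suc n) = crr_tau b k n *
     ((1 - \<i> * of_real (crr_c b (k + Suc n))) / (1 + \<i> * of_real (crr_c b (k + Suc n))))"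

text \<open>The index is that of the Verblunsky coefficient, so \<open>crr_beta b k (n - 1)\<close> involves \<open>M\<close> and
  \<open>c\<close> at \<open>n\<close> and \<open>k + n\<close>.\<close>

definition crr_beta :: "complex \<Rightarrow> nat \<Rightarrow> nat \<Rightarrow> complex" where
  "crr_beta b k n = 1 / crr_tau b k n *
     ((1 - 2 * of_real (crr_M (Re b) k (Suc n)) - \<i> * of_real (crr_c b (k + Suc n))) /
      (1 - \<i> * of_real (crr_c b (k + Suc n))))"

primrec crr_gamma :: "complex \<Rightarrow> nat \<Rightarrow> nat \<Rightarrow> real" where
  "crr_gamma b k 0 = 1"
| "crr_gamma b k (Suc n) = (1 - crr_M (Re b) k (Suc n)) * crr_gamma b k n"

text \<open>The quotient \<open>f t / (t - x)\<close> for a differentiable \<open>f\<close> with \<open>f x = 0\<close>. Its singularity at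
  \<open>t = x\<close> is removable, and it is given its limit there instead of the value 0 of a division by
  zero.\<close>

definition quotient_at :: "(real \<Rightarrow> real) \<Rightarrow> real \<Rightarrow> real \<Rightarrow> real" where
  "quotient_at f x t = (if t = x then deriv f x else f t / (t - x))"

end

theory Submission
  imports Defs
begin

text \<open>The argument takes place on the unit circle. Let \<open>\<Phi>\<^sub>n\<close> be the monic orthogonal polynomials
  of \<open>\<nu>\<close>. The map \<open>x \<mapsto> (x + \<i>) / (x - \<i>)\<close> carries \<open>P\<^sub>n\<close> to a polynomial \<open>R\<^sub>n\<close> of degree \<open>n\<close>
  (\<open>crr_poly_eq_kernel_poly\<close>), and the Verblunsky coefficients are such that \<open>(z - 1) R\<^sub>n\<close> is a
  multiple of \<open>z \<Phi>\<^sub>n - \<tau>\<^sub>n \<Phi>\<^sub>n\<^sup>*\<close> (\<open>zF_minus_F_star\<close>). By the Christoffel-Darboux formula \<open>R\<^sub>n\<close> is then a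
  multiple of the reproducing kernel at 1: the integral of \<open>R\<^sub>n\<close> against the conjugate of a
  polynomial \<open>q\<close> of degree at most \<open>n\<close> is \<open>2\<^sup>n \<gamma>\<^sub>n cnj (q(1))\<close> (\<open>circle_ip_R\<close>). Under the same map
  \<open>x\<^sup>j P\<^sub>n / (x\<^sup>2 + 1)\<^sup>n\<close> becomes, up to a constant, \<open>R\<^sub>n\<close> times the conjugate of \<open>(1 + z)\<^sup>j (1 - z)\<^sup>n\<^sup>-\<^sup>j\<close>, and
  the value of the latter at 1 is \<open>2\<^sup>n\<close> for \<open>j = n\<close> and 0 otherwise. This is the orthogonality relation.

  The transport to the line forgets a point mass at 1, so the relation also requires \<open>\<nu>{1} = 0\<close>;
  already \<open>\<gamma>\<^sub>0 = 1\<close> says that no mass is lost. Testing the kernel against itself bounds \<open>\<nu>{1}\<close> by the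
  reciprocal of the partial sums of \<open>\<Sum>\<^sub>n \<Prod>\<^sub>j M\<^sub>j / (1 - M\<^sub>j)\<close> (\<open>measure_1_le\<close>). For the maximal
  parameter sequence this series dominates a multiple of the harmonic series, and the bound
  tends to 0 (\<open>no_atom_1\<close>).

  For the second formula put \<open>f\<^sub>n(t) = P\<^sub>n(t) / (1 + t\<^sup>2)\<^sup>n\<close>. The integrand is \<open>(1 + x\<^sup>2)\<^sup>n / M\<^sub>1\<close> times the
  divided difference of \<open>f\<^sub>n\<close> at \<open>t\<close> and \<open>x\<close>. The three-term recursion yields one for the
  divided differences with additional terms in \<open>f\<close>, all of which have integral zero by
  the orthogonality relation except in the first step. What is left is the recursion of the
  polynomials with parameter \<open>k + 1\<close> (\<open>has_bochner_integral_crr_quotient\<close>).\<close>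

section \<open>The Szego recursion\<close>

text \<open>Components: the monic orthogonal polynomial \<open>\<Phi>\<^sub>n\<close> with Verblunsky coefficients \<open>a\<close> and its reversed
  polynomial \<open>\<Phi>\<^sub>n\<^sup>*\<close>. Running both recursions at once avoids a formal definition of reversal;
  \<open>snd_szego_eq_reversed\<close> shows that the second component is the reversal of the first.\<close>

primrec szego :: "(nat \<Rightarrow> complex) \<Rightarrow> nat \<Rightarrow> complex poly \<times> complex poly" where
  "szego a 0 = (1, 1)"
| "szego a (Suc n) =
     (pCons 0 (fst (szego a n)) - smult (cnj (a n)) (snd (szego a n)),
      snd (szego a n) - smult (a n) (pCons 0 (fst (szego a n))))"

lemma circle_cnj: "cmod z = 1 \<Longrightarrow> z * cnj z = 1"
  by (simp flip: complex_norm_square)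

lemma snd_szego_eq_reversed:
  assumes "cmod z = 1"
  shows "poly (snd (szego a n)) z = z ^ n * cnj (poly (fst (szego a n)) z)"
proof (induction n)
  case (Suc n)
  have *: "z ^ Suc n * cnj (poly (snd (szego a n)) z) = z * poly (fst (szego a n)) z"
    unfolding Suc using circle_cnj[OF assms]
    by (simp add: algebra_simps flip: power_mult_distrib)
  have "z ^ Suc n * cnj (poly (fst (szego a (Suc n))) z)
      = (z * cnj z) * (z ^ n * cnj (poly (fst (szego a n)) z))
        - a n * (z ^ Suc n * cnj (poly (snd (szego a n)) z))"
    by (simp add: algebra_simps)
  also have "\<dots> = poly (snd (szego a (Suc n))) z"
    unfolding * circle_cnj[OF assms] using Suc by (simp add: algebra_simps)
  finally show ?case ..
qed simp

lemma degree_snd_szego: "degree (snd (szego a n)) \<le> n"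
  and degree_fst_szego: "degree (fst (szego a n)) = n"
  and lead_coeff_fst_szego: "coeff (fst (szego a n)) n = 1"
  and coeff_0_snd_szego: "coeff (snd (szego a n)) 0 = 1"
proof (induction n)
  case (Suc n)
  {
    case 1
    show ?case using Suc(1,2) by (auto intro!: degree_diff_le degree_smult_le[THEN order_trans] degree_pCons_le[THEN order_trans])
  next
    case 3
    show ?case using Suc(1,3) by (simp add: coeff_eq_0)
    moreover have "degree (fst (szego a (Suc n))) \<le> Suc n"
      using Suc(1,2) by (auto intro!: degree_diff_le degree_smult_le[THEN order_trans] degree_pCons_le[THEN order_trans])
    ultimately show "degree (fst (szego a (Suc n))) = Suc n"
      by (metis le_antisym le_degree zero_neq_one)
  next
    case 4
    show ?case using Suc by simp
  }
qed auto

text \<open>A positive measure on the circle makes the polynomials an inner product space on which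
  multiplication by \<open>z\<close> is isometric. Infinite support makes the inner product definite.\<close>

locale circle_measure =
  fixes nu :: "complex measure"
  assumes circle: "circle_prob_measure nu"
begin

sublocale prob_space nu
  using circle by (simp add: circle_prob_measure_def)

lemma sets_nu: "sets nu = sets borel"
  using circle by (simp add: circle_prob_measure_def)

lemma space_nu: "space nu = UNIV"
  using sets_eq_imp_space_eq[OF sets_nu] by simp

lemma AE_circle: "AE z in nu. cmod z = 1"
  using circle by (simp add: circle_prob_measure_def)

lemma measurable_nu_continuous: "continuous_on UNIV f \<Longrightarrow> f \<in> borel_measurable nu"
  by (simp add: measurable_cong_sets[OF sets_nu refl] borel_measurable_continuous_onI)

lemma integrable_nu_continuous:
  fixes f :: "complex \<Rightarrow> complex"
  assumes "continuous_on UNIV f"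
  shows "integrable nu f"
proof -
  have "bounded (f ` sphere 0 1)"
    using assms by (intro compact_imp_bounded compact_continuous_image continuous_on_subset[OF assms]) auto
  then obtain B where "\<forall>z\<in>sphere 0 1. norm (f z) \<le> B"
    unfolding bounded_iff by blast
  hence "\<And>z. cmod z = 1 \<Longrightarrow> norm (f z) \<le> B"
    by simp
  thus ?thesis
    using AE_circle measurable_nu_continuous[OF assms] by (auto intro!: integrable_const_bound[of _ B])
qed

definition circle_ip :: "complex poly \<Rightarrow> complex poly \<Rightarrow> complex" where
  "circle_ip p q = (\<integral>z. poly p z * cnj (poly q z) \<partial>nu)"

lemma continuous_circle_ip: "continuous_on UNIV (\<lambda>z. poly p z * cnj (poly q z))"
  by (intro continuous_intros)

lemmas integrable_circle_ip = integrable_nu_continuous[OF continuous_circle_ip]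

lemma circle_ip_add_left: "circle_ip (p + q) r = circle_ip p r + circle_ip q r"
  unfolding circle_ip_def by (simp add: distrib_right integrable_circle_ip)

lemma circle_ip_diff_left: "circle_ip (p - q) r = circle_ip p r - circle_ip q r"
  unfolding circle_ip_def by (simp add: left_diff_distrib integrable_circle_ip)

lemma circle_ip_smult_left: "circle_ip (smult c p) r = c * circle_ip p r"
  unfolding circle_ip_def by (simp add: mult.assoc)

lemma circle_ip_commute: "circle_ip q p = cnj (circle_ip p q)"
  unfolding circle_ip_def by (subst Bochner_Integration.integral_cnj[symmetric]) (simp add: mult.commute)

lemma circle_ip_0_right: "circle_ip p 0 = 0"
  by (simp add: circle_ip_def)

lemma circle_ip_add_right: "circle_ip r (p + q) = circle_ip r p + circle_ip r q"
  by (subst (1 2 3) circle_ip_commute) (simp add: circle_ip_add_left)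

lemma circle_ip_smult_right: "circle_ip r (smult c p) = cnj c * circle_ip r p"
  by (subst (1 2) circle_ip_commute) (simp add: circle_ip_smult_left)

lemma circle_ip_sum_right: "finite A \<Longrightarrow> circle_ip r (\<Sum>i\<in>A. f i) = (\<Sum>i\<in>A. circle_ip r (f i))"
  by (induction A rule: finite_induct) (auto simp: circle_ip_0_right circle_ip_add_right)

lemma circle_ip_right_expand:
  assumes "degree q \<le> n"
  shows "circle_ip p q = (\<Sum>i\<le>n. cnj (coeff q i) * circle_ip p (monom 1 i))"
proof -
  have "circle_ip p q = circle_ip p (\<Sum>i\<le>n. smult (coeff q i) (monom 1 i))"
    using poly_as_sum_of_monoms'[OF assms] by (simp add: smult_monom)
  thus ?thesis by (simp only: circle_ip_sum_right circle_ip_smult_right finite_atMost)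
qed

lemma circle_ip_cong:
  assumes "\<And>z. cmod z = 1 \<Longrightarrow>
    poly p z * cnj (poly q z) = poly p' z * cnj (poly q' z)"
  shows "circle_ip p q = circle_ip p' q'"
  unfolding circle_ip_def using AE_circle assms
  by (intro integral_cong_AE measurable_nu_continuous continuous_circle_ip) auto

lemma circle_ip_pCons_0: "circle_ip (pCons 0 p) (pCons 0 q) = circle_ip p q"
proof (rule circle_ip_cong)
  fix z :: complex assume "cmod z = 1"
  have "poly (pCons 0 p) z * cnj (poly (pCons 0 q) z) = (z * cnj z) * (poly p z * cnj (poly q z))"
    by (simp add: algebra_simps)
  thus "poly (pCons 0 p) z * cnj (poly (pCons 0 q) z) = poly p z * cnj (poly q z)"
    by (simp add: circle_cnj[OF \<open>cmod z = 1\<close>])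
qed

lemma circle_ip_self: "circle_ip p p = of_real (\<integral>z. (cmod (poly p z))\<^sup>2 \<partial>nu)"
  unfolding circle_ip_def by (simp add: integral_complex_of_real flip: complex_norm_square of_real_power)

lemma integrable_cmod_poly_square: "integrable nu (\<lambda>z. (cmod (poly p z))\<^sup>2)"
  using integrable_norm[OF integrable_circle_ip[of p p]] by (simp add: norm_mult power2_eq_square)

text \<open>If the integral of \<open>|p|\<^sup>2\<close> vanishes, then the open set where \<open>p \<noteq> 0\<close> is null, so the support
  consists of roots of \<open>p\<close>. A nonzero polynomial has only finitely many of them.\<close>

lemma circle_ip_self_eq_0:
  assumes "circle_ip p p = 0"
  shows "p = 0"
proof (rule ccontr)
  assume p: "p \<noteq> 0"
  have "AE z in nu. (cmod (poly p z))\<^sup>2 = 0"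
    using assms integrable_cmod_poly_square[of p]
    by (subst integral_nonneg_eq_0_iff_AE[symmetric]) (auto simp: circle_ip_self)
  hence AE: "AE z in nu. poly p z = 0" by simp
  have op: "open {z. poly p z \<noteq> 0}"
    by (intro open_Collect_neq continuous_intros)
  have "emeasure nu {z. poly p z \<noteq> 0} = 0"
    using AE op by (subst (asm) AE_iff_measurable[OF _ refl]) (auto simp: sets_nu space_nu)
  hence "measure_support nu \<subseteq> {z. poly p z = 0}"
    using op by (fastforce simp: measure_support_def)
  hence "finite (measure_support nu)"
    using poly_roots_finite[OF p] finite_subset by blast
  thus False using circle by (simp add: circle_prob_measure_def)
qed

lemma circle_ip_eq_0_low_degree:
  assumes "\<And>j. j < n \<Longrightarrow> circle_ip p (monom 1 j) = 0" "degree q < n \<or> q = 0"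
  shows "circle_ip p q = 0"
proof (cases "q = 0")
  case False
  hence "degree q \<le> n - 1" "n > 0" using assms(2) by auto
  thus ?thesis using assms(1) by (subst circle_ip_right_expand[of q "n - 1"]) auto
qed (simp add: circle_ip_0_right)

text \<open>The difference of two monic candidates has degree below \<open>n\<close>, so it is orthogonal to itself.
  This is what gives the description in \<open>monic_OP\<close> a unique solution.\<close>

lemma monic_OP_eqI:
  assumes "degree p = n" "coeff p n = 1" "\<And>j. j < n \<Longrightarrow> circle_ip p (monom 1 j) = 0"
  shows "monic_OP nu n = p"
  unfolding monic_OP_def
proof (rule the_equality)
  show "degree p = n \<and> lead_coeff p = 1 \<and> (\<forall>j<n. (\<integral>z. poly p z * cnj (z ^ j) \<partial>nu) = 0)"
    using assms by (simp add: circle_ip_def poly_monom)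
next
  fix q
  assume q: "degree q = n \<and> lead_coeff q = 1 \<and> (\<forall>j<n. (\<integral>z. poly q z * cnj (z ^ j) \<partial>nu) = 0)"
  have deg: "degree (q - p) < n \<or> q - p = 0"
  proof (cases "n = 0")
    case True
    thus ?thesis using q assms by (metis degree_0_id diff_self)
  next
    case False
    have "degree (q - p) \<le> n" using q assms by (intro degree_diff_le) auto
    moreover have "coeff (q - p) n = 0" using q assms by auto
    ultimately show ?thesis using False
      by (metis leading_coeff_0_iff le_neq_implies_less)
  qed
  have "circle_ip (q - p) (monom 1 j) = 0" if "j < n" for j
    using q assms that by (simp add: circle_ip_diff_left) (simp add: circle_ip_def poly_monom)
  from circle_ip_eq_0_low_degree[OF this deg] show "q = p"
    using circle_ip_self_eq_0[of "q - p"] by simp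
qed

text \<open>Reversal turns orthogonality to \<open>1, \<dots>, z\<^sup>n\<^sup>-\<^sup>1\<close> into orthogonality to \<open>z, \<dots>, z\<^sup>n\<close>.\<close>

lemma circle_ip_snd_szego:
  assumes "j \<le> n"
  shows "circle_ip (snd (szego a n)) (monom 1 j) = cnj (circle_ip (fst (szego a n)) (monom 1 (n - j)))"
  unfolding circle_ip_commute[of "monom 1 (n - j)", symmetric]
proof (rule circle_ip_cong)
  fix z :: complex assume z: "cmod z = 1"
  have "z ^ n * cnj z ^ j = z ^ (n - j) * (z * cnj z) ^ j"
    using assms by (simp add: power_mult_distrib mult.assoc[symmetric] flip: power_add)
  thus "poly (snd (szego a n)) z * cnj (poly (monom 1 j) z) =
      poly (monom 1 (n - j)) z * cnj (poly (fst (szego a n)) z)"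
    using z by (simp add: snd_szego_eq_reversed circle_cnj poly_monom mult_ac)
qed

text \<open>Szego's theorem: the recursion driven by the Verblunsky coefficients of a measure yields its
  orthogonal polynomials. In \<open>z \<Phi>\<^sub>n - \<alpha> \<Phi>\<^sub>n\<^sup>*\<close> both terms are orthogonal to \<open>z, \<dots>, z\<^sup>n\<close>, and \<open>\<alpha>\<close> is
  chosen to make the difference orthogonal to 1 as well. So this is the next orthogonal
  polynomial, and its value at 0 is \<open>-\<alpha>\<close>, which identifies \<open>\<alpha>\<close> as the conjugate of the Verblunsky
  coefficient.\<close>

lemma orthogonal_szego_verblunsky:
  "j < n \<Longrightarrow> circle_ip (fst (szego (verblunsky nu) n)) (monom 1 j) = 0"
proof (induction n arbitrary: j)
  case (Suc n)
  define P where "P = fst (szego (verblunsky nu) n)"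
  define Q where "Q = snd (szego (verblunsky nu) n)"
  have degP: "degree P = n" "coeff P n = 1" and degQ: "degree Q \<le> n" "coeff Q 0 = 1"
    unfolding P_def Q_def
    by (rule degree_fst_szego lead_coeff_fst_szego degree_snd_szego coeff_0_snd_szego)+
  have orthP: "circle_ip P (monom 1 j) = 0" if "j < n" for j
    using Suc.IH that by (simp add: P_def)
  have Q: "circle_ip Q (monom 1 j) = cnj (circle_ip P (monom 1 (n - j)))" if "j \<le> n" for j
    using circle_ip_snd_szego that by (simp add: P_def Q_def)
  have "circle_ip P (monom 1 n) \<noteq> 0"
  proof
    assume "circle_ip P (monom 1 n) = 0"
    hence "circle_ip P (monom 1 j) = 0" if "j < Suc n" for j
      using orthP[of j] that by (cases "j = n") auto
    hence "circle_ip P P = 0"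
      using degP(1) by (metis circle_ip_eq_0_low_degree lessI)
    hence "P = 0" by (rule circle_ip_self_eq_0)
    thus False using degP by simp
  qed
  \<comment> \<open>This inner product is the squared norm of \<open>\<Phi>\<^sub>n\<close>; it may be divided by.\<close>
  hence Q0: "circle_ip Q (monom 1 0) \<noteq> 0" using Q[of 0] by simp
  define \<alpha> where "\<alpha> = circle_ip (pCons 0 P) (monom 1 0) / circle_ip Q (monom 1 0)"
  have orth: "circle_ip (pCons 0 P - smult \<alpha> Q) (monom 1 j) = 0" if "j < Suc n" for j
  proof (cases j)
    case 0
    thus ?thesis using Q0 by (simp add: circle_ip_diff_left circle_ip_smult_left \<alpha>_def)
  next
    case (Suc i)
    hence "i < n" using that by simp
    have "circle_ip (pCons 0 P) (monom 1 j) = circle_ip P (monom 1 i)"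
      unfolding Suc monom_Suc by (rule circle_ip_pCons_0)
    moreover have "circle_ip Q (monom 1 j) = 0"
      using Q[of j] orthP[of "n - j"] that Suc by simp
    ultimately show ?thesis
      using orthP[OF \<open>i < n\<close>] by (simp add: circle_ip_diff_left circle_ip_smult_left)
  qed
  have cf: "coeff (pCons 0 P - smult \<alpha> Q) (Suc n) = 1"
    using degP degQ by (simp add: coeff_eq_0)
  have "degree (pCons 0 P - smult \<alpha> Q) \<le> Suc n"
    using degP degQ
    by (auto intro!: degree_diff_le degree_smult_le[THEN order_trans] degree_pCons_le[THEN order_trans])
  with cf have "degree (pCons 0 P - smult \<alpha> Q) = Suc n"
    by (metis le_antisym le_degree zero_neq_one)
  hence "monic_OP nu (Suc n) = pCons 0 P - smult \<alpha> Q"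
    using cf orth by (intro monic_OP_eqI)
  hence "verblunsky nu n = cnj \<alpha>"
    using degQ by (simp add: verblunsky_def poly_0_coeff_0)
  hence "fst (szego (verblunsky nu) (Suc n)) = pCons 0 P - smult \<alpha> Q"
    by (simp add: P_def Q_def)
  thus ?case using orth[OF Suc.prems] by simp
qed simp

end

section \<open>The reproducing kernel at 1\<close>

text \<open>The factor \<open>\<rho>\<^sub>n\<close> that turns the Szego recursion into one with coefficients affine in \<open>c\<close> and \<open>M\<close>.
  Its phase is the one in the Verblunsky coefficients: \<open>\<tau>\<^sub>n = cnj \<rho>\<^sub>n / \<rho>\<^sub>n\<close>.\<close>

definition rho :: "(nat \<Rightarrow> real) \<Rightarrow> nat \<Rightarrow> complex" where
  "rho c n = (\<Prod>j<n. 1 + \<i> * of_real (c j))"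

text \<open>Up to a positive factor, \<open>R\<^sub>n\<close> is the Christoffel-Darboux kernel \<open>\<zeta> \<mapsto> K\<^sub>n(\<zeta>, 1)\<close>
  of the measure below (\<open>circle_ip_R\<close>). The recursion is the image of the CRR recursion under
  \<open>x \<mapsto> (x + \<i>) / (x - \<i>)\<close>, with \<open>d\<close> written in terms of its parameter sequence \<open>M\<close>.\<close>

fun kernel_poly :: "(nat \<Rightarrow> real) \<Rightarrow> (nat \<Rightarrow> real) \<Rightarrow> nat \<Rightarrow> complex poly" where
  "kernel_poly c M 0 = 1"
| "kernel_poly c M (Suc 0) = [:1 - \<i> * of_real (c 0), 1 + \<i> * of_real (c 0):]"
| "kernel_poly c M (Suc (Suc n)) =
     [:1 - \<i> * of_real (c (Suc n)), 1 + \<i> * of_real (c (Suc n)):] * kernel_poly c M (Suc n)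
     - smult (of_real (4 * ((1 - M n) * M (Suc n)))) (pCons 0 (kernel_poly c M n))"

lemma one_plus_minus_i_neq_0 [simp]: "1 + \<i> * complex_of_real x \<noteq> 0" "1 - \<i> * complex_of_real x \<noteq> 0"
  by (auto simp: complex_eq_iff)

lemma rho_Suc: "rho c (Suc n) = (1 + \<i> * of_real (c n)) * rho c n"
  by (simp add: rho_def)

lemma rho_neq_0 [simp]: "rho c n \<noteq> 0"
  by (simp add: rho_def)

lemma degree_kernel_poly: "degree (kernel_poly c M n) \<le> n"
proof (induction c M n rule: kernel_poly.induct)
  case (3 c M n)
  have "degree ([:1 - \<i> * of_real (c (Suc n)), 1 + \<i> * of_real (c (Suc n)):] * kernel_poly c M (Suc n))
      \<le> 1 + Suc n"
    by (rule degree_mult_le[THEN order_trans], rule add_mono) (use 3 in auto)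
  moreover have "degree (smult (of_real (4 * ((1 - M n) * M (Suc n)))) (pCons 0 (kernel_poly c M n)))
      \<le> Suc n"
    using 3 by (intro degree_smult_le[THEN order_trans] degree_pCons_le[THEN order_trans]) auto
  ultimately show ?case
    by (auto intro!: degree_diff_le)
qed auto

text \<open>The Verblunsky coefficients have the shape of those in the theorem, with sequences indexed from 0:
  \<open>c n\<close> and \<open>M n\<close> stand for \<open>c\<^sub>k\<^sub>+\<^sub>n\<^sub>+\<^sub>1\<close> and \<open>M\<^sub>n\<^sub>+\<^sub>1\<close>.\<close>

locale kernel_measure = circle_measure +
  fixes c M :: "nat \<Rightarrow> real"
  assumes M: "0 < M n" "M n < 1"
    and verblunsky_nu: "verblunsky nu n = rho c n / cnj (rho c n) *
          ((1 - 2 * of_real (M n) - \<i> * of_real (c n)) / (1 - \<i> * of_real (c n)))"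
begin

abbreviation "R \<equiv> kernel_poly c M"

text \<open>The multiples \<open>\<rho>\<^sub>n \<Phi>\<^sub>n\<close> and \<open>cnj \<rho>\<^sub>n \<Phi>\<^sub>n\<^sup>*\<close> are again reversals of each other.\<close>

definition "F n = smult (rho c n) (fst (szego (verblunsky nu) n))"
definition "F_star n = smult (cnj (rho c n)) (snd (szego (verblunsky nu) n))"

lemma poly_F_Suc:
  "poly (F (Suc n)) z = (1 + \<i> * of_real (c n)) * (z * poly (F n) z)
     - (1 - 2 * of_real (M n) + \<i> * of_real (c n)) * poly (F_star n) z"
proof -
  have *: "rho c (Suc n) * cnj (verblunsky nu n)
      = cnj (rho c n) * (1 - 2 * of_real (M n) + \<i> * of_real (c n))"
    unfolding verblunsky_nu rho_Suc by simp
  have "poly (F (Suc n)) z = rho c (Suc n) * (z * poly (fst (szego (verblunsky nu) n)) z)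
      - (rho c (Suc n) * cnj (verblunsky nu n)) * poly (snd (szego (verblunsky nu) n)) z"
    by (simp add: F_def right_diff_distrib mult.assoc)
  thus ?thesis
    unfolding * by (simp add: rho_Suc F_def F_star_def mult_ac)
qed

lemma poly_F_star_Suc:
  "poly (F_star (Suc n)) z = (1 - \<i> * of_real (c n)) * poly (F_star n) z
     - (1 - 2 * of_real (M n) - \<i> * of_real (c n)) * (z * poly (F n) z)"
proof -
  have *: "cnj (rho c (Suc n)) * verblunsky nu n
      = rho c n * (1 - 2 * of_real (M n) - \<i> * of_real (c n))"
    unfolding verblunsky_nu rho_Suc by simp
  have "poly (F_star (Suc n)) z = cnj (rho c (Suc n)) * poly (snd (szego (verblunsky nu) n)) z
      - (cnj (rho c (Suc n)) * verblunsky nu n) * (z * poly (fst (szego (verblunsky nu) n)) z)"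
    by (simp add: F_star_def right_diff_distrib mult.assoc)
  thus ?thesis
    unfolding * by (simp add: rho_Suc F_def F_star_def mult_ac)
qed

lemma F_0 [simp]: "F 0 = 1" "F_star 0 = 1"
  by (simp_all add: F_def F_star_def rho_def)

text \<open>In the difference of the two recursions the terms with \<open>c\<close> cancel. This is why the
  last coefficient in the three-term recursion for \<open>R\<close> depends on \<open>M\<close> alone.\<close>

lemma F_minus_F_star:
  "poly (F (Suc n)) z - poly (F_star (Suc n)) z
     = 2 * (1 - of_real (M n)) * (z * poly (F n) z - poly (F_star n) z)"
  unfolding poly_F_Suc poly_F_star_Suc by (simp add: algebra_simps)

text \<open>The Christoffel-Darboux formula at 1. Combining the two recursions expresses
  \<open>z F\<^sub>n\<^sub>+\<^sub>2 - F\<^sub>n\<^sub>+\<^sub>2\<^sup>*\<close> through \<open>z F\<^sub>n\<^sub>+\<^sub>1 - F\<^sub>n\<^sub>+\<^sub>1\<^sup>*\<close> and \<open>F\<^sub>n\<^sub>+\<^sub>1 - F\<^sub>n\<^sub>+\<^sub>1\<^sup>*\<close>. By \<open>F_minus_F_star\<close> the latter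
  leads back to \<open>z F\<^sub>n - F\<^sub>n\<^sup>*\<close> with the factor \<open>2 (1 - M\<^sub>n)\<close>, which together with a factor
  \<open>2 M\<^sub>n\<^sub>+\<^sub>1\<close> makes up the chain sequence in the recursion for \<open>R\<close>.\<close>

lemma zF_minus_F_star: "z * poly (F n) z - poly (F_star n) z = (z - 1) * poly (R n) z"
proof (induction n rule: induct_nat_012)
  case 0
  show ?case unfolding F_0 by simp
next
  case 1
  show ?case unfolding poly_F_Suc[of 0] poly_F_star_Suc[of 0] F_0 by (simp add: algebra_simps)
next
  case (ge2 n)
  define f g r where fgr_def: "f = poly (F (Suc n)) z" "g = poly (F_star (Suc n)) z" "r = poly (R n) z"
  have fg: "f - g = 2 * (1 - of_real (M n)) * ((z - 1) * r)"
    unfolding fgr_def F_minus_F_star ge2 ..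
  have R: "z * f - g = (z - 1) * poly (R (Suc n)) z"
    unfolding fgr_def by (rule ge2)
  have "z * poly (F (Suc (Suc n))) z - poly (F_star (Suc (Suc n))) z
      = (z * (1 + \<i> * of_real (c (Suc n))) + (1 - \<i> * of_real (c (Suc n)))) * (z * f - g)
        - 2 * of_real (M (Suc n)) * z * (f - g)"
    unfolding poly_F_Suc[of "Suc n"] poly_F_star_Suc[of "Suc n"] fgr_def
    by (simp add: algebra_simps)
  also have "\<dots> = (z - 1) * poly (R (Suc (Suc n))) z"
    unfolding R fg by (simp add: fgr_def algebra_simps)
  finally show ?case .
qed

text \<open>The two preceding relations differ by \<open>(z - 1) F\<^sub>n\<^sub>+\<^sub>1\<close>, and \<open>z - 1\<close> cancels.\<close>

lemma F_Suc_eq: "F (Suc n) = R (Suc n) - smult (2 * (1 - of_real (M n))) (R n)"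
proof -
  have "[:-1, 1:] * F (Suc n) = [:-1, 1:] * (R (Suc n) - smult (2 * (1 - of_real (M n))) (R n))"
  proof (subst poly_eq_poly_eq_iff[symmetric], rule ext)
    fix z :: complex
    have "(z - 1) * poly (F (Suc n)) z
        = (z * poly (F (Suc n)) z - poly (F_star (Suc n)) z)
          - (poly (F (Suc n)) z - poly (F_star (Suc n)) z)"
      by (simp add: algebra_simps)
    also have "\<dots> = (z - 1) * (poly (R (Suc n)) z - 2 * (1 - of_real (M n)) * poly (R n) z)"
      unfolding F_minus_F_star unfolding zF_minus_F_star by (simp add: algebra_simps)
    finally show "poly ([:-1, 1:] * F (Suc n)) z =
        poly ([:-1, 1:] * (R (Suc n) - smult (2 * (1 - of_real (M n))) (R n))) z"
      by (simp only: poly_mult poly_diff poly_smult) simp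
  qed
  thus ?thesis unfolding mult_cancel_left by simp
qed

lemma orthogonal_F: "j < n \<Longrightarrow> circle_ip (F n) (monom 1 j) = 0"
  by (simp add: F_def circle_ip_smult_left orthogonal_szego_verblunsky)

lemma orthogonal_F_star: "0 < j \<Longrightarrow> j \<le> n \<Longrightarrow> circle_ip (F_star n) (monom 1 j) = 0"
  by (simp add: F_star_def circle_ip_smult_left circle_ip_snd_szego orthogonal_szego_verblunsky)

text \<open>The polynomial \<open>(z - 1) R\<^sub>n = z F\<^sub>n - F\<^sub>n\<^sup>*\<close> is orthogonal to \<open>z, \<dots>, z\<^sup>n\<close>, which says that consecutive
  moments of \<open>R\<^sub>n\<close> agree.\<close>

lemma circle_ip_R_monom: "s \<le> n \<Longrightarrow> circle_ip (R n) (monom 1 s) = circle_ip (R n) 1"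
proof (induction s)
  case (Suc s)
  have "pCons 0 (R n) - R n = pCons 0 (F n) - F_star n"
    by (subst poly_eq_poly_eq_iff[symmetric], rule ext)
      (use zF_minus_F_star in \<open>simp add: algebra_simps\<close>)
  hence "circle_ip (pCons 0 (R n)) (monom 1 (Suc s)) - circle_ip (R n) (monom 1 (Suc s))
      = circle_ip (pCons 0 (F n)) (monom 1 (Suc s)) - circle_ip (F_star n) (monom 1 (Suc s))"
    by (metis circle_ip_diff_left)
  also have "\<dots> = 0"
    unfolding orthogonal_F_star[OF zero_less_Suc Suc.prems]
    unfolding monom_Suc circle_ip_pCons_0 using orthogonal_F[of s n] Suc.prems by simp
  finally show ?case
    using Suc by (simp add: monom_Suc circle_ip_pCons_0)
qed simp

definition kernel_mean :: "nat \<Rightarrow> real" where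
  "kernel_mean n = (\<Prod>j<n. 2 * (1 - M j))"

lemma kernel_mean_pos: "kernel_mean n > 0"
  using M by (auto simp: kernel_mean_def intro!: prod_pos)

text \<open>Integrating \<open>F_Suc_eq\<close> kills the orthogonal polynomial and leaves a one-step recursion.\<close>

lemma circle_ip_R_1: "circle_ip (R n) 1 = of_real (kernel_mean n)"
proof (induction n)
  case 0
  show ?case by (simp add: circle_ip_def kernel_mean_def prob_space)
next
  case (Suc n)
  have "circle_ip (F (Suc n)) (monom 1 0) = 0" by (rule orthogonal_F) simp
  hence "circle_ip (R (Suc n)) 1 = 2 * (1 - of_real (M n)) * circle_ip (R n) 1"
    unfolding F_Suc_eq by (simp add: circle_ip_diff_left circle_ip_smult_left)
  thus ?case using Suc by (simp add: kernel_mean_def)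
qed

text \<open>The reproducing property, the form in which orthogonality is transported to the line.\<close>

lemma circle_ip_R:
  assumes "degree q \<le> n"
  shows "circle_ip (R n) q = of_real (kernel_mean n) * cnj (poly q 1)"
proof -
  have "circle_ip (R n) q = (\<Sum>i\<le>n. cnj (coeff q i) * of_real (kernel_mean n))"
    unfolding circle_ip_right_expand[OF assms] by (intro sum.cong) (auto simp: circle_ip_R_monom circle_ip_R_1)
  also have "\<dots> = of_real (kernel_mean n) * cnj (\<Sum>i\<le>n. coeff q i)"
    by (simp add: sum_distrib_left mult.commute)
  also have "(\<Sum>i\<le>n. coeff q i) = poly q 1"
    unfolding poly_altdef using assms
    by (intro sum.mono_neutral_cong_right) (auto simp: coeff_eq_0)
  finally show ?thesis .
qed

lemma poly_F_1: "poly (F n) 1 = of_real (\<Prod>j<n. 2 * M j)"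
proof (induction n)
  case (Suc n)
  have "poly (F_star n) 1 = poly (F n) 1"
    using zF_minus_F_star[of 1 n] by simp
  thus ?case unfolding poly_F_Suc using Suc by (simp add: algebra_simps)
qed (unfold F_0, simp)

lemma poly_R_1: "poly (R n) 1 = of_real (kernel_mean n * (\<Sum>i\<le>n. \<Prod>j<i. M j / (1 - M j)))"
proof (induction n)
  case 0
  show ?case by (simp add: kernel_mean_def)
next
  case (Suc n)
  have "(\<Prod>j<Suc n. 2 * M j) = kernel_mean (Suc n) * (\<Prod>j<Suc n. M j / (1 - M j))"
    unfolding kernel_mean_def prod.distrib[symmetric] using M(2) by (intro prod.cong) (auto simp: less_le field_simps)
  moreover have "poly (R (Suc n)) 1 = of_real (\<Prod>j<Suc n. 2 * M j) + 2 * (1 - of_real (M n)) * poly (R n) 1"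
    unfolding poly_F_1[symmetric] F_Suc_eq by simp
  moreover have "2 * (1 - of_real (M n)) * poly (R n) 1 =
      of_real (kernel_mean (Suc n) * (\<Sum>i\<le>n. \<Prod>j<i. M j / (1 - M j)))"
    unfolding Suc by (simp add: kernel_mean_def)
  ultimately show ?case
    by (simp only: of_real_add[symmetric] distrib_left[symmetric] sum.atMost_Suc add.commute)
qed

text \<open>The Christoffel bound for the mass at a point: compare \<open>\<nu>{1} |R\<^sub>n(1)|\<^sup>2\<close> with the integral of
  \<open>|R\<^sub>n|\<^sup>2\<close>, which the reproducing property evaluates to a multiple of \<open>R\<^sub>n(1)\<close>. The kernel is the
  polynomial of degree at most \<open>n\<close> for which this comparison is sharpest.\<close>

lemma measure_1_le: "measure nu {1} * (\<Sum>i\<le>n. \<Prod>j<i. M j / (1 - M j)) \<le> 1"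
proof -
  define S where "S = (\<Sum>i\<le>n. \<Prod>j<i. M j / (1 - M j))"
  have "(\<Prod>j<i. M j / (1 - M j)) > 0" for i
    using M by (auto intro!: prod_pos)
  hence S: "S > 0" unfolding S_def by (intro sum_pos) auto
  have int: "integrable nu (\<lambda>z. indicator {1} z * (kernel_mean n * S)\<^sup>2)"
    by (intro integrable_mult_left integrable_real_indicator)
      (auto simp: sets_nu less_top[symmetric])
  have "measure nu {1} * (kernel_mean n * S)\<^sup>2 = (\<integral>z. indicator {1} z * (kernel_mean n * S)\<^sup>2 \<partial>nu)"
    by (simp add: sets_nu space_nu)
  also have "\<dots> \<le> (\<integral>z. (cmod (poly (R n) z))\<^sup>2 \<partial>nu)"
    using kernel_mean_pos[of n] S int
    by (intro integral_mono integrable_cmod_poly_square)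
      (auto simp: sets_nu indicator_def poly_R_1 norm_mult mult.commute simp flip: S_def)
  also have "\<dots> = kernel_mean n * (kernel_mean n * S)"
  proof -
    have "complex_of_real (\<integral>z. (cmod (poly (R n) z))\<^sup>2 \<partial>nu) = of_real (kernel_mean n * (kernel_mean n * S))"
      unfolding circle_ip_self[symmetric] circle_ip_R[OF degree_kernel_poly] poly_R_1 S_def by simp
    thus ?thesis by (simp only: of_real_eq_iff)
  qed
  finally have "(measure nu {1} * S) * (kernel_mean n * kernel_mean n * S) \<le> 1 * (kernel_mean n * kernel_mean n * S)"
    by (simp add: power2_eq_square algebra_simps)
  thus ?thesis
    unfolding S_def[symmetric] using kernel_mean_pos[of n] S by (subst (asm) mult_le_cancel_right_pos) auto
qed

lemma measure_1_eq_0: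
  assumes "\<not> summable (\<lambda>n. \<Prod>j<n. M j / (1 - M j))"
  shows "measure nu {1} = 0"
proof (rule ccontr)
  assume ne: "measure nu {1} \<noteq> 0"
  hence pos: "measure nu {1} > 0" by (simp add: less_le)
  have "summable (\<lambda>n. \<Prod>j<n. M j / (1 - M j))"
  proof (rule bounded_imp_summable)
    show "0 \<le> (\<Prod>j<n. M j / (1 - M j))" for n
      using M by (auto intro!: prod_nonneg simp: less_imp_le)
    show "(\<Sum>i\<le>n. \<Prod>j<i. M j / (1 - M j)) \<le> 1 / measure nu {1}" for n
      using measure_1_le[of n] pos by (simp add: field_simps)
  qed
  with assms show False ..
qed

end

section \<open>Transport to the real line\<close>

lemma circle_to_line_borel: "circle_to_line \<in> borel_measurable borel"
  unfolding circle_to_line_def by measurable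

text \<open>The transport drops the point 1, so it preserves integrals only if 1 carries no mass. The
  integrand on the circle is an everywhere continuous complex function, which makes integrability
  automatic.\<close>

lemma (in circle_measure) has_bochner_integral_line_measure:
  fixes f :: "real \<Rightarrow> real" and g :: "complex \<Rightarrow> complex"
  assumes atom: "measure nu {1} = 0"
    and f: "f \<in> borel_measurable borel" and g: "continuous_on UNIV g"
    and eq: "\<And>x. of_real (f x) = g (line_to_circle x)"
    and I: "(\<integral>z. g z \<partial>nu) = of_real I"
  shows "has_bochner_integral (line_measure nu) f I"
proof -
  let ?S = "sphere 0 1 - {1} :: complex set"
  have S: "?S \<in> sets nu" by (auto simp: sets_nu)
  have meas: "(\<lambda>z. f (circle_to_line z)) \<in> borel_measurable nu"
    unfolding measurable_cong_sets[OF sets_nu refl]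
    using f circle_to_line_borel by (rule measurable_compose_rev)
  have "AE z in nu. z \<notin> {1}"
    using atom by (intro AE_not_in) (auto simp: null_sets_def sets_nu emeasure_eq_measure)
  with AE_circle have AE: "AE z in nu. z \<in> ?S"
    by eventually_elim auto
  have "has_bochner_integral nu g (of_real I)"
    using integrable_nu_continuous[OF g] I by (simp add: has_bochner_integral_iff)
  hence Re: "has_bochner_integral nu (\<lambda>z. Re (g z)) I"
    using has_bochner_integral_Re by fastforce
  have "has_bochner_integral nu (\<lambda>z. indicator ?S z *\<^sub>R f (circle_to_line z)) I"
  proof (subst has_bochner_integral_cong_AE)
    show "AE z in nu. indicator ?S z *\<^sub>R f (circle_to_line z) = Re (g z)"
      using AE
    proof eventually_elim
      case (elim z)
      have "Re (g z) = f (circle_to_line z)"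
        using eq[of "circle_to_line z"] line_to_circle_to_line[OF elim] by (metis Re_complex_of_real)
      thus ?case using elim by simp
    qed
  qed (use Re meas S in auto)
  hence "has_bochner_integral (restrict_space nu ?S) (\<lambda>z. f (circle_to_line z)) I"
    using S by (simp add: has_bochner_integral_iff integrable_restrict_space integral_restrict_space space_nu)
  thus ?thesis
    unfolding line_measure_def
    using f circle_to_line_borel
    by (intro has_bochner_integral_distr measurable_restrict_space1)
      (simp_all add: measurable_cong_sets[OF sets_nu refl])
qed

section \<open>The CRR polynomials as kernels on the circle\<close>

text \<open>With \<open>u = x - \<i>\<close> and \<open>z = (x + \<i>) / (x - \<i>)\<close> one has \<open>u z = x + \<i>\<close>, hence
  \<open>(1 - \<i> c) u + (1 + \<i> c) u z = 2 (x - c)\<close> and \<open>u\<^sup>2 z = x\<^sup>2 + 1\<close>. So \<open>u\<^sup>n R\<^sub>n(z)\<close> and \<open>2\<^sup>n P\<^sub>n(x)\<close> satisfy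
  the same recursion.\<close>

lemma crr_poly_eq_kernel_poly:
  fixes b :: complex and k :: nat and x :: real and M :: "nat \<Rightarrow> real"
  assumes d: "\<And>n. crr_d (Re b) (k + n + 2) = (1 - M n) * M (Suc n)"
  shows "2 ^ n * of_real (poly (crr_poly b k n) x)
    = (of_real x - \<i>) ^ n * poly (kernel_poly (\<lambda>n. crr_c b (k + Suc n)) M n) (line_to_circle x)"
proof (induction n rule: induct_nat_012)
  case 0
  show ?case by simp
next
  case 1
  have "of_real x - \<i> \<noteq> 0" by (simp add: complex_eq_iff)
  hence *: "(of_real x - \<i>) * line_to_circle x = of_real x + \<i>"
    by (simp add: line_to_circle_def)
  have "(of_real x - \<i>) * poly (kernel_poly (\<lambda>n. crr_c b (k + Suc n)) M (Suc 0)) (line_to_circle x)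
      = (1 - \<i> * of_real (crr_c b (k + 1))) * (of_real x - \<i>)
        + (1 + \<i> * of_real (crr_c b (k + 1))) * ((of_real x - \<i>) * line_to_circle x)"
    by (simp add: algebra_simps)
  also have "\<dots> = 2 * of_real (poly (crr_poly b k (Suc 0)) x)"
    unfolding * by (simp add: algebra_simps)
  finally show ?case by simp
next
  case (ge2 n)
  define u where "u = of_real x - \<i>"
  define z where "z = line_to_circle x"
  define c where "c = complex_of_real (crr_c b (k + n + 2))"
  define D where "D = complex_of_real (crr_d (Re b) (k + n + 2))"
  have D: "D = (1 - of_real (M n)) * of_real (M (Suc n))"
    unfolding D_def d by simp
  define R where "R n = poly (kernel_poly (\<lambda>n. crr_c b (k + Suc n)) M n) z" for n
  define P where "P n = complex_of_real (poly (crr_poly b k n) x)" for n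
  have "u \<noteq> 0" by (simp add: u_def complex_eq_iff)
  hence uz: "u * z = of_real x + \<i>"
    by (simp add: u_def z_def line_to_circle_def)
  have IH: "2 ^ n * P n = u ^ n * R n" "2 ^ Suc n * P (Suc n) = u ^ Suc n * R (Suc n)"
    using ge2 unfolding P_def R_def u_def z_def .
  have "u ^ Suc (Suc n) * R (Suc (Suc n))
      = ((1 - \<i> * c) * u + (1 + \<i> * c) * (u * z)) * (u ^ Suc n * R (Suc n))
        - 4 * D * (u * (u * z)) * (u ^ n * R n)"
    by (simp add: R_def c_def D algebra_simps)
  also have "(1 - \<i> * c) * u + (1 + \<i> * c) * (u * z) = 2 * (of_real x - c)"
    unfolding uz by (simp add: u_def algebra_simps)
  also have "u * (u * z) = of_real x ^ 2 + 1"
    unfolding uz by (simp add: u_def algebra_simps power2_eq_square)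
  also have "2 * (of_real x - c) * (u ^ Suc n * R (Suc n))
      - 4 * D * (of_real x ^ 2 + 1) * (u ^ n * R n) = 2 ^ Suc (Suc n) * P (Suc (Suc n))"
    unfolding IH[symmetric] by (simp add: P_def c_def D_def algebra_simps power2_eq_square)
  finally show ?case unfolding P_def R_def u_def z_def ..
qed

text \<open>All that the argument uses about the maximal parameter sequence. The last inequality is where
  maximality enters: it keeps the products of these quotients above a multiple of the harmonic
  sequence.\<close>

lemma crr_M_facts:
  assumes "k = 0 \<and> lam > 1/2 \<or> k \<ge> 1 \<and> lam > 0"
  shows crr_M_pos: "0 < crr_M lam k (Suc n)"
    and crr_M_less_1: "crr_M lam k (Suc n) < 1"
    and crr_d_eq_crr_M: "crr_d lam (k + n + 2) = (1 - crr_M lam k (Suc n)) * crr_M lam k (Suc (Suc n))"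
    and crr_M_quotient_ge: "real (k + n) / real (k + n + 1)
        \<le> crr_M lam k (Suc n) / (1 - crr_M lam k (Suc n))"
proof -
  define t where "t = real k + real n"
  have shift: "2 * lam + real k + real (Suc m) - 2 = 2 * lam + (real k + real m) - 1"
    "lam + real k + real (Suc m) - 1 = lam + (real k + real m)"
    "real k + real (Suc m) - 1 = real k + real m" for m
    by simp_all
  have M: "crr_M lam k (Suc m) = (if lam > 1/2 then (2 * lam + (real k + real m) - 1) / (2 * (lam + (real k + real m)))
      else (real k + real m) / (2 * (lam + (real k + real m))))" for m
    using assms by (subst crr_M_explicit) (auto simp only: shift divide_divide_eq_left times_divide_eq_left mult_1 split: if_split)
  have pos: "lam > 0" "t \<ge> 0" "lam + t > 0" "lam + t + 1 > 0" "lam > 1/2 \<or> t \<ge> 1"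
    using assms by (auto simp: t_def)
  have M1: "crr_M lam k (Suc n) = (if lam > 1/2 then (2 * lam + t - 1) / (2 * (lam + t)) else t / (2 * (lam + t)))"
    and M2: "crr_M lam k (Suc (Suc n)) = (if lam > 1/2 then (2 * lam + t) / (2 * (lam + t + 1)) else (t + 1) / (2 * (lam + t + 1)))"
    using M[of n] M[of "Suc n"] by (simp_all add: t_def algebra_simps)
  have comp: "1 - crr_M lam k (Suc n) = (if lam > 1/2 then (t + 1) / (2 * (lam + t)) else (2 * lam + t) / (2 * (lam + t)))"
  proof -
    have "1 - u / (2 * (lam + t)) = (2 * (lam + t) - u) / (2 * (lam + t))" for u
      using pos by (simp add: diff_divide_distrib)
    moreover have "2 * (lam + t) - (2 * lam + t - 1) = t + 1" "2 * (lam + t) - t = 2 * lam + t"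
      by simp_all
    ultimately show ?thesis
      unfolding M1 by (cases "lam > 1/2") (simp_all only: if_True if_False)
  qed
  show "0 < crr_M lam k (Suc n)"
    unfolding M1 using pos by auto
  have "0 < 1 - crr_M lam k (Suc n)"
    unfolding comp using pos by auto
  thus "crr_M lam k (Suc n) < 1" by simp
  have "crr_d lam (k + n + 2) = 1/4 * ((t + 1) * (2 * lam + t)) / ((lam + t) * (lam + t + 1))"
    unfolding crr_d_def Let_def t_def by (simp add: algebra_simps)
  also have "\<dots> = (1 - crr_M lam k (Suc n)) * crr_M lam k (Suc (Suc n))"
  proof -
    have "1/4 * (u * v) / (w * w') = u / (2 * w) * (v / (2 * w'))" for u v w w' :: real
      by simp
    from this[of "t + 1" "2 * lam + t" "lam + t" "lam + t + 1"]
      this[of "2 * lam + t" "t + 1" "lam + t" "lam + t + 1"]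
    show ?thesis
      unfolding comp M2
      by (cases "lam > 1/2") (simp_all only: if_True if_False mult.commute[of "t + 1" "2 * lam + t"])
  qed
  finally show "crr_d lam (k + n + 2) = (1 - crr_M lam k (Suc n)) * crr_M lam k (Suc (Suc n))" .
  have "t / (t + 1) \<le> crr_M lam k (Suc n) / (1 - crr_M lam k (Suc n))"
  proof (cases "lam > 1/2")
    case True
    hence "crr_M lam k (Suc n) / (1 - crr_M lam k (Suc n)) = (2 * lam + t - 1) / (t + 1)"
      unfolding comp unfolding M1 using pos by simp
    moreover have "t / (t + 1) \<le> (2 * lam + t - 1) / (t + 1)"
      using True pos by (intro divide_right_mono) auto
    ultimately show ?thesis by simp
  next
    case False
    hence "crr_M lam k (Suc n) / (1 - crr_M lam k (Suc n)) = t / (2 * lam + t)"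
      unfolding comp unfolding M1 using pos by simp
    moreover have "t / (t + 1) \<le> t / (2 * lam + t)"
      using False pos by (intro divide_left_mono) auto
    ultimately show ?thesis by simp
  qed
  thus "real (k + n) / real (k + n + 1) \<le> crr_M lam k (Suc n) / (1 - crr_M lam k (Suc n))"
    by (simp add: t_def add_ac)
qed

text \<open>The lower bounds telescope to \<open>C / (k + n)\<close>. The quotient at index 0 needs a separate
  treatment, because for \<open>k = 0\<close> the corresponding bound would be 0.\<close>

lemma not_summable_prod_quotients:
  fixes q :: "nat \<Rightarrow> real"
  assumes pos: "q 0 > 0" and ge: "\<And>n. real (k + Suc n) / real (k + Suc n + 1) \<le> q (Suc n)"
  shows "\<not> summable (\<lambda>n. \<Prod>j<n. q j)"
proof
  assume "summable (\<lambda>n. \<Prod>j<n. q j)"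
  hence sm: "summable (\<lambda>n. \<Prod>j<Suc n. q j)" by (subst summable_Suc_iff)
  define C where "C = q 0 * real (k + 1)"
  have C: "C > 0" using pos by (simp add: C_def)
  have bound: "C / real (n + (k + 1)) \<le> (\<Prod>j<Suc n. q j)" for n
  proof (induction n)
    case (Suc n)
    have "C / real (Suc n + (k + 1)) = C / real (n + (k + 1)) * (real (k + Suc n) / real (k + Suc n + 1))"
      by (simp add: divide_simps add_ac)
    also have "\<dots> \<le> (\<Prod>j<Suc n. q j) * q (Suc n)"
      using Suc C by (intro mult_mono ge order_trans[OF _ Suc]) auto
    finally show ?case by simp
  qed (simp add: C_def)
  have "summable (\<lambda>n. C / real (n + (k + 1)))"
    by (rule summable_comparison_test'[OF sm, of 0]) (use bound C in auto)
  hence "summable (\<lambda>n. inverse C * (C / real (n + (k + 1))))"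
    by (rule summable_mult)
  hence "summable (\<lambda>n. inverse (real (n + (k + 1))))"
    using C by (simp add: field_simps)
  thus False
    using not_summable_harmonic[where 'a = real] summable_iff_shift[of "\<lambda>i. inverse (real i)" "k + 1"]
    by simp
qed

section \<open>Orthogonality on the real line\<close>

lemma crr_tau_eq_rho: "crr_tau b k n = cnj (rho (\<lambda>n. crr_c b (k + Suc n)) n) / rho (\<lambda>n. crr_c b (k + Suc n)) n"
  by (induction n) (simp_all add: rho_Suc, simp_all add: rho_def mult_ac)

locale crr_measure = circle_measure +
  fixes b :: complex and k :: nat
  assumes k_lam: "k = 0 \<and> Re b > 1/2 \<or> k \<ge> 1 \<and> Re b > 0"
    and verblunsky_crr: "verblunsky nu n = crr_beta b k n"

sublocale crr_measure \<subseteq> kernel_measure nu "\<lambda>n. crr_c b (k + Suc n)" "\<lambda>n. crr_M (Re b) k (Suc n)"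
proof
  fix n
  show "0 < crr_M (Re b) k (Suc n)" "crr_M (Re b) k (Suc n) < 1"
    using k_lam by (rule crr_M_pos crr_M_less_1)+
  show "verblunsky nu n = rho (\<lambda>n. crr_c b (k + Suc n)) n / cnj (rho (\<lambda>n. crr_c b (k + Suc n)) n) *
      ((1 - 2 * of_real (crr_M (Re b) k (Suc n)) - \<i> * of_real (crr_c b (k + Suc n)))
       / (1 - \<i> * of_real (crr_c b (k + Suc n))))"
    unfolding verblunsky_crr crr_beta_def crr_tau_eq_rho by simp
qed

context crr_measure
begin

lemma no_atom_1: "measure nu {1} = 0"
proof (rule measure_1_eq_0, rule not_summable_prod_quotients)
  show "0 < crr_M (Re b) k (Suc 0) / (1 - crr_M (Re b) k (Suc 0))"
    using M[of 0] by simp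
  show "real (k + Suc n) / real (k + Suc n + 1)
      \<le> crr_M (Re b) k (Suc (Suc n)) / (1 - crr_M (Re b) k (Suc (Suc n)))" for n
    by (rule crr_M_quotient_ge[OF k_lam])
qed

lemma kernel_mean_eq_gamma: "kernel_mean n = 2 ^ n * crr_gamma b k n"
  by (induction n) (simp_all add: kernel_mean_def)

text \<open>On the circle the integrand is \<open>\<kappa> R\<^sub>n cnj q\<close> with \<open>q = (1 + z)\<^sup>j (1 - z)\<^sup>n\<^sup>-\<^sup>j\<close>, of degree \<open>n\<close>: with
  \<open>u = x + \<i>\<close>, the conjugates of \<open>1 + z\<close> and \<open>1 - z\<close> are \<open>2 x / u\<close> and \<open>2 \<i> / u\<close>.
  The reproducing property leaves a multiple of \<open>q(1)\<close>, which vanishes unless \<open>j = n\<close>.\<close>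

lemma has_bochner_integral_crr:
  assumes "j \<le> n"
  shows "has_bochner_integral (line_measure nu)
    (\<lambda>x. x ^ j * (poly (crr_poly b k n) x / (x\<^sup>2 + 1) ^ n)) (if n = j then crr_gamma b k n else 0)"
proof -
  define q :: "complex poly" where "q = [:1, 1:] ^ j * [:1, -1:] ^ (n - j)"
  define \<kappa> where "\<kappa> = 1 / (4 ^ n * \<i> ^ (n - j))"
  have "degree q \<le> j + (n - j)"
    unfolding q_def by (rule degree_mult_le[THEN order_trans], rule add_mono) (auto intro!: degree_power_le[THEN order_trans])
  hence deg_q: "degree q \<le> n" using assms by simp
  have four: "(4::complex) ^ n = 2 ^ n * 2 ^ n" by (simp flip: power_mult_distrib)
  have q_1: "poly q 1 = (if n = j then 2 ^ n else 0)"
    using assms by (simp add: q_def)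
  show ?thesis
  proof (rule has_bochner_integral_line_measure[OF no_atom_1])
    show "(\<lambda>x. x ^ j * (poly (crr_poly b k n) x / (x\<^sup>2 + 1) ^ n)) \<in> borel_measurable borel"
      by (intro borel_measurable_continuous_onI continuous_intros) (auto simp: add_nonneg_eq_0_iff)
    show "continuous_on UNIV (\<lambda>z. \<kappa> * (poly (R n) z * cnj (poly q z)))"
      by (intro continuous_intros)
    show "(\<integral>z. \<kappa> * (poly (R n) z * cnj (poly q z)) \<partial>nu) = of_real (if n = j then crr_gamma b k n else 0)"
    proof -
      have "(\<integral>z. \<kappa> * (poly (R n) z * cnj (poly q z)) \<partial>nu) = \<kappa> * circle_ip (R n) q"
        by (simp add: circle_ip_def)
      also have "\<dots> = of_real (if n = j then crr_gamma b k n else 0)"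
        unfolding circle_ip_R[OF deg_q] q_1 kernel_mean_eq_gamma
        by (simp add: \<kappa>_def four)
      finally show ?thesis .
    qed
    fix x :: real
    define u v z where uvz_def: "u = of_real x + \<i>" "v = of_real x - \<i>" "z = line_to_circle x"
    have uv: "u \<noteq> 0" "v \<noteq> 0" by (simp_all add: uvz_def complex_eq_iff)
    have cz: "cnj z = v / u"
      by (simp add: uvz_def line_to_circle_def)
    have "1 + cnj z = 2 * of_real x / u" "1 - cnj z = 2 * \<i> / u"
      using uv unfolding cz by (simp_all add: uvz_def field_simps)
    hence "cnj (poly q z) = (2 * of_real x / u) ^ j * (2 * \<i> / u) ^ (n - j)"
      by (simp add: q_def)
    also have "\<dots> = 2 ^ (j + (n - j)) * \<i> ^ (n - j) * of_real x ^ j / u ^ (j + (n - j))"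
      by (simp add: power_add power_mult_distrib power_divide)
    finally have q: "cnj (poly q z) = 2 ^ n * \<i> ^ (n - j) * of_real x ^ j / u ^ n"
      using assms by simp
    have "2 ^ n * of_real (poly (crr_poly b k n) x) = v ^ n * poly (R n) z"
      unfolding uvz_def by (rule crr_poly_eq_kernel_poly) (rule crr_d_eq_crr_M[OF k_lam])
    hence P: "complex_of_real (poly (crr_poly b k n) x) = v ^ n * poly (R n) z / 2 ^ n"
      by (simp add: field_simps)
    have "complex_of_real (x\<^sup>2 + 1) = u * v"
      by (simp add: uvz_def algebra_simps power2_eq_square)
    hence "of_real (x ^ j * (poly (crr_poly b k n) x / (x\<^sup>2 + 1) ^ n))
        = of_real x ^ j * (v ^ n * poly (R n) z / 2 ^ n / (u * v) ^ n)"
      by (simp only: of_real_mult of_real_divide of_real_power P)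
    also have "\<dots> = of_real x ^ j * poly (R n) z / (2 ^ n * u ^ n)"
      using uv by (simp add: power_mult_distrib)
    also have "\<dots> = \<kappa> * (poly (R n) z * cnj (poly q z))"
      unfolding q \<kappa>_def four by simp
    finally show "of_real (x ^ j * (poly (crr_poly b k n) x / (x\<^sup>2 + 1) ^ n))
        = \<kappa> * (poly (R n) (line_to_circle x) * cnj (poly q (line_to_circle x)))"
      by (simp add: uvz_def)
  qed
qed

end

section \<open>The associated polynomials as an integral\<close>

definition crr_ratio :: "complex \<Rightarrow> nat \<Rightarrow> nat \<Rightarrow> real \<Rightarrow> real" where
  "crr_ratio b k n t = poly (crr_poly b k n) t / (t\<^sup>2 + 1) ^ n"

text \<open>With \<open>f\<^sub>n(t) = P\<^sub>n(t) / (1 + t\<^sup>2)\<^sup>n\<close>, this is \<open>(1 + x\<^sup>2)\<^sup>n (f\<^sub>n(t) - f\<^sub>n(x)) / (t - x)\<close>, continuously extended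
  to \<open>t = x\<close> (\<open>crr_quotient_mult\<close>, \<open>isCont_crr_quotient\<close>). The recursion is the divided difference of
  \<open>crr_ratio_rec\<close>. Taking it as the definition avoids any division by \<open>t - x\<close> and allows
  termwise integration.\<close>

fun crr_quotient :: "complex \<Rightarrow> nat \<Rightarrow> real \<Rightarrow> nat \<Rightarrow> real \<Rightarrow> real" where
  "crr_quotient b k x 0 t = 0"
| "crr_quotient b k x (Suc 0) t = 1 - (t + x) * crr_ratio b k 1 t"
| "crr_quotient b k x (Suc (Suc n)) t =
     (x - crr_c b (k + n + 2)) * crr_quotient b k x (Suc n) t
     - crr_d (Re b) (k + n + 2) * (x\<^sup>2 + 1) * crr_quotient b k x n t
     + (x\<^sup>2 + 1) ^ Suc n * (crr_ratio b k (Suc n) t - (t + x) * crr_ratio b k (Suc (Suc n)) t)"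

lemma square_plus_1_neq_0: "x\<^sup>2 + 1 \<noteq> (0 :: real)"
  by (simp add: add_nonneg_eq_0_iff)

lemma crr_ratio_rec:
  "(t\<^sup>2 + 1) * crr_ratio b k (Suc (Suc n)) t
     = (t - crr_c b (k + n + 2)) * crr_ratio b k (Suc n) t - crr_d (Re b) (k + n + 2) * crr_ratio b k n t"
proof -
  have alg: "w * (((t - c) * p - d * (w * q)) / (w * (w * v))) = (t - c) * (p / (w * v)) - d * (q / v)"
    if "w \<noteq> 0" "v \<noteq> 0" for w v c d p q :: real
    using that by (simp add: field_simps)
  have "poly (crr_poly b k (Suc (Suc n))) t = (t - crr_c b (k + n + 2)) * poly (crr_poly b k (Suc n)) t
      - crr_d (Re b) (k + n + 2) * ((t\<^sup>2 + 1) * poly (crr_poly b k n) t)"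
    by (simp add: power2_eq_square algebra_simps)
  thus ?thesis
    unfolding crr_ratio_def power_Suc
    using alg[of "t\<^sup>2 + 1" "(t\<^sup>2 + 1) ^ n"] square_plus_1_neq_0[of t] by simp
qed

text \<open>The product rule for divided differences turns \<open>(1 + t\<^sup>2) f\<^sub>n\<^sub>+\<^sub>2(t)\<close> into
  \<open>(1 + x\<^sup>2) \<Delta>f\<^sub>n\<^sub>+\<^sub>2 + (t + x) f\<^sub>n\<^sub>+\<^sub>2(t)\<close> and \<open>(t - c) f\<^sub>n\<^sub>+\<^sub>1(t)\<close> into \<open>(x - c) \<Delta>f\<^sub>n\<^sub>+\<^sub>1 + f\<^sub>n\<^sub>+\<^sub>1(t)\<close>.\<close>

lemma crr_quotient_mult:
  "(t - x) * crr_quotient b k x n t = (x\<^sup>2 + 1) ^ n * crr_ratio b k n t - poly (crr_poly b k n) x"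
proof (induction n rule: induct_nat_012)
  case 0
  show ?case by (simp add: crr_ratio_def)
next
  case 1
  have "(t\<^sup>2 + 1) * crr_ratio b k (Suc 0) t = t - crr_c b (k + 1)"
    using square_plus_1_neq_0[of t] by (simp add: crr_ratio_def)
  moreover have "(t - x) * crr_quotient b k x (Suc 0) t
      = t - x - (t\<^sup>2 + 1) * crr_ratio b k (Suc 0) t + (x\<^sup>2 + 1) * crr_ratio b k (Suc 0) t"
    by (simp add: algebra_simps power2_eq_square)
  ultimately show ?case by simp
next
  case (ge2 n)
  define X T where "X = x\<^sup>2 + 1" and "T = t\<^sup>2 + 1"
  define c d where "c = crr_c b (k + n + 2)" and "d = crr_d (Re b) (k + n + 2)"
  define f where "f n = crr_ratio b k n t" for n
  have "(t - x) * (t + x) = T - X"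
    by (simp add: X_def T_def algebra_simps power2_eq_square)
  hence TX: "(t - x) * ((t + x) * f (Suc (Suc n))) = T * f (Suc (Suc n)) - X * f (Suc (Suc n))"
    by (simp add: left_diff_distrib flip: mult.assoc)
  have "(t - x) * crr_quotient b k x (Suc (Suc n)) t
      = (x - c) * ((t - x) * crr_quotient b k x (Suc n) t) - d * X * ((t - x) * crr_quotient b k x n t)
        + X ^ Suc n * ((t - x) * f (Suc n) - (t - x) * ((t + x) * f (Suc (Suc n))))"
    by (simp add: X_def c_def d_def f_def algebra_simps)
  also have "\<dots> = X ^ Suc (Suc n) * f (Suc (Suc n))
      - ((x - c) * poly (crr_poly b k (Suc n)) x - d * X * poly (crr_poly b k n) x)"
    unfolding ge2 TX
    unfolding T_def f_def crr_ratio_rec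
    by (simp add: X_def c_def d_def algebra_simps)
  also have "(x - c) * poly (crr_poly b k (Suc n)) x - d * X * poly (crr_poly b k n) x
      = poly (crr_poly b k (Suc (Suc n))) x"
    by (simp add: X_def c_def d_def algebra_simps power2_eq_square)
  finally show ?case by (simp only: X_def f_def)
qed

lemma isCont_crr_ratio: "isCont (crr_ratio b k n) t"
  unfolding crr_ratio_def by (intro continuous_intros) (simp add: square_plus_1_neq_0)

lemma isCont_crr_quotient: "isCont (crr_quotient b k x n) t"
  by (induction n rule: induct_nat_012)
    (auto intro!: continuous_intros isCont_o2[OF _ isCont_crr_ratio] simp: isCont_crr_ratio)

text \<open>At \<open>t = x\<close> the derivative is read off from the continuous factorisation (Caratheodory's
  criterion).\<close>

lemma quotient_at_crr:
  "quotient_at (\<lambda>s. (1 + x\<^sup>2) ^ n * poly (crr_poly b k n) s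
                    - (1 + s\<^sup>2) ^ n * poly (crr_poly b k n) x) x t
     = (1 + t\<^sup>2) ^ n * crr_quotient b k x n t"
proof -
  define g where "g s = (1 + x\<^sup>2) ^ n * poly (crr_poly b k n) s
                    - (1 + s\<^sup>2) ^ n * poly (crr_poly b k n) x" for s
  define h where "h s = (1 + s\<^sup>2) ^ n * crr_quotient b k x n s" for s
  have g: "g s = h s * (s - x)" for s
  proof -
    have "h s * (s - x) = (s\<^sup>2 + 1) ^ n * ((s - x) * crr_quotient b k x n s)"
      by (simp add: h_def add.commute)
    also have "\<dots> = g s"
      unfolding crr_quotient_mult
      using square_plus_1_neq_0[of s] by (simp add: g_def crr_ratio_def right_diff_distrib add.commute)
    finally show ?thesis ..
  qed
  have "isCont h x"
    unfolding h_def by (intro continuous_intros isCont_crr_quotient)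
  moreover have "g s - g x = h s * (s - x)" for s
    using g[of s] g[of x] by simp
  ultimately have "DERIV g x :> h x"
    unfolding CARAT_DERIV by blast
  hence "quotient_at g x t = h t"
    using g[of t] by (auto simp: quotient_at_def DERIV_imp_deriv)
  thus ?thesis unfolding g_def h_def .
qed

text \<open>Orthogonality removes the terms \<open>f\<^sub>n\<^sub>+\<^sub>1(t) - (t + x) f\<^sub>n\<^sub>+\<^sub>2(t)\<close> from the integrated recursion, so what
  remains is the CRR recursion with indices raised by one. Only at \<open>n = 1\<close> does such a
  term survive: there \<open>1 - (t + x) f\<^sub>1(t)\<close> integrates to \<open>1 - \<gamma>\<^sub>1 = M\<^sub>1\<close>.\<close>

lemma (in crr_measure) has_bochner_integral_crr_quotient:
  "has_bochner_integral (line_measure nu) (crr_quotient b k x n)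
     (case n of 0 \<Rightarrow> 0 | Suc m \<Rightarrow> crr_M (Re b) k 1 * poly (crr_poly b (k + 1) m) x)"
proof (induction n rule: induct_nat_012)
  case 0
  show ?case by (simp add: has_bochner_integral_zero)
next
  case 1
  have "has_bochner_integral (line_measure nu)
      (\<lambda>t. 1 - (t * crr_ratio b k 1 t + x * crr_ratio b k 1 t))
      (1 - (crr_gamma b k 1 + x * 0))"
    using has_bochner_integral_crr[of 0 0] has_bochner_integral_crr[of 1 1] has_bochner_integral_crr[of 0 1]
    by (intro has_bochner_integral_diff has_bochner_integral_add has_bochner_integral_mult_right)
      (simp_all add: crr_ratio_def)
  thus ?case
    by (simp add: algebra_simps)
next
  case (ge2 n)
  define v where "v n = (case n of 0 \<Rightarrow> 0 | Suc m \<Rightarrow> crr_M (Re b) k 1 * poly (crr_poly b (k + 1) m) x)" for n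
  have "has_bochner_integral (line_measure nu)
      (\<lambda>t. (x - crr_c b (k + n + 2)) * crr_quotient b k x (Suc n) t
        - crr_d (Re b) (k + n + 2) * (x\<^sup>2 + 1) * crr_quotient b k x n t
        + (x\<^sup>2 + 1) ^ Suc n * (crr_ratio b k (Suc n) t
            - (t * crr_ratio b k (Suc (Suc n)) t + x * crr_ratio b k (Suc (Suc n)) t)))
      ((x - crr_c b (k + n + 2)) * v (Suc n)
        - crr_d (Re b) (k + n + 2) * (x\<^sup>2 + 1) * v n
        + (x\<^sup>2 + 1) ^ Suc n * (0 - (0 + x * 0)))"
    using ge2 has_bochner_integral_crr[of 0 "Suc n"] has_bochner_integral_crr[of 0 "Suc (Suc n)"]
      has_bochner_integral_crr[of 1 "Suc (Suc n)"]
    by (intro has_bochner_integral_diff has_bochner_integral_add has_bochner_integral_mult_right)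
      (simp_all add: crr_ratio_def v_def)
  also have "(\<lambda>t. (x - crr_c b (k + n + 2)) * crr_quotient b k x (Suc n) t
        - crr_d (Re b) (k + n + 2) * (x\<^sup>2 + 1) * crr_quotient b k x n t
        + (x\<^sup>2 + 1) ^ Suc n * (crr_ratio b k (Suc n) t
            - (t * crr_ratio b k (Suc (Suc n)) t + x * crr_ratio b k (Suc (Suc n)) t)))
      = crr_quotient b k x (Suc (Suc n))"
    by (simp add: fun_eq_iff distrib_right)
  also have "(x - crr_c b (k + n + 2)) * v (Suc n)
        - crr_d (Re b) (k + n + 2) * (x\<^sup>2 + 1) * v n
        + (x\<^sup>2 + 1) ^ Suc n * (0 - (0 + x * 0)) = v (Suc (Suc n))"
    by (cases n) (simp_all add: v_def algebra_simps power2_eq_square)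
  finally show ?case unfolding v_def .
qed

theorem theorem3p4:
  fixes lam eta :: real and b :: complex and k :: nat
    and nu :: "complex measure" and phi :: "real measure"
  assumes b: "b = Complex lam eta"
    and k_lam: "(k = 0 \<and> lam > 1/2) \<or> (k \<ge> 1 \<and> lam > 0)"
    and nu: "circle_prob_measure nu"
    and verblunsky_nu: "\<forall>n\<ge>1. verblunsky nu (n - 1) = crr_beta b k (n - 1)"
    and phi: "phi = line_measure nu"
  shows "(\<forall>n. \<forall>j\<le>n.
            has_bochner_integral phi
              (\<lambda>x. x ^ j * (poly (crr_poly b k n) x / (x\<^sup>2 + 1) ^ n))
              (if n = j then crr_gamma b k n else 0)) \<and>
         (\<forall>n\<ge>1. \<forall>x.
            has_bochner_integral phi
              (\<lambda>t. quotient_at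
                     (\<lambda>s. (1 + x\<^sup>2) ^ n * poly (crr_poly b k n) s
                          - (1 + s\<^sup>2) ^ n * poly (crr_poly b k n) x) x t
                   / (crr_M lam k 1 * (1 + t\<^sup>2) ^ n))
              (poly (crr_poly b (k + 1) (n - 1)) x))"
proof -
  have lam: "lam = Re b" using b by simp
  interpret crr_measure nu b k
  proof
    show "circle_prob_measure nu" by (rule nu)
    show "k = 0 \<and> Re b > 1/2 \<or> k \<ge> 1 \<and> Re b > 0" using k_lam unfolding lam .
    show "verblunsky nu n = crr_beta b k n" for n
      using verblunsky_nu[rule_format, of "Suc n"] by simp
  qed
  show ?thesis
  proof (intro conjI allI impI)
    show "has_bochner_integral phi (\<lambda>x. x ^ j * (poly (crr_poly b k n) x / (x\<^sup>2 + 1) ^ n))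
        (if n = j then crr_gamma b k n else 0)" if "j \<le> n" for n j
      unfolding phi using that by (rule has_bochner_integral_crr)
  next
    fix n :: nat and x :: real
    assume "n \<ge> 1"
    then obtain m where n: "n = Suc m" by (cases n) auto
    have M1: "crr_M lam k 1 \<noteq> 0"
      using M(1)[of 0] by (simp add: lam)
    have "has_bochner_integral phi (\<lambda>t. crr_quotient b k x n t / crr_M lam k 1)
        (crr_M lam k 1 * poly (crr_poly b (k + 1) m) x / crr_M lam k 1)"
      using has_bochner_integral_crr_quotient[of x n] unfolding phi n lam
      by (intro has_bochner_integral_divide_zero) simp
    moreover have "quotient_at (\<lambda>s. (1 + x\<^sup>2) ^ n * poly (crr_poly b k n) s
          - (1 + s\<^sup>2) ^ n * poly (crr_poly b k n) x) x t / (crr_M lam k 1 * (1 + t\<^sup>2) ^ n)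
        = crr_quotient b k x n t / crr_M lam k 1" for t
      unfolding quotient_at_crr using square_plus_1_neq_0[of t] by (simp add: add.commute)
    ultimately show "has_bochner_integral phi
        (\<lambda>t. quotient_at (\<lambda>s. (1 + x\<^sup>2) ^ n * poly (crr_poly b k n) s
              - (1 + s\<^sup>2) ^ n * poly (crr_poly b k n) x) x t / (crr_M lam k 1 * (1 + t\<^sup>2) ^ n))
        (poly (crr_poly b (k + 1) (n - 1)) x)"
      using M1 by (simp add: n)
  qed
qed

end
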